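(* Let $d\ge2$ and $\tau_0,\ldots,\tau_d>0$. Let $e_0,\ldots,e_d$ be the standard orthonormal basis of $\mathbb R^{d+1}$, consider the simplex $S:=[e_0/\tau_0,\ldots,e_d/\tau_d]\subseteq\mathbb R^{d+1}$, and let $k\in\{0,\ldots,d\}$. The internal and external angles of $S$ at its $k$-dimensional face $F:=[e_0/\tau_0,\ldots,e_k/\tau_k]$ are $$\beta(F,S)=\mathbf g_{d-k}(-\tau_0^2-\cdots-\tau_d^2;\ \tau_{k+1}^2,\ldots,\tau_d^2;\ 1,\ldots,1),$$ $$\gamma(F,S)=\mathbf g_{d-k}(\tau_0^2+\cdots+\tau_k^2;\ \tau_{k+1}^2,\ldots,\tau_d^2;\ 1,\ldots,1).$$ Here, for every integer $\ell\ge0$, all $\lambda_1,\ldots,\lambda_\ell>0$, and every $\lambda_0\in\mathbb R$ satisfying either $\lambda_0>0$ or $\lambda_0<-\lambda_1-\cdots-\lambda_\ell$, $$\mathbf g_\ell(\lambda_0;\lambda_1,\ldots,\lambda_\ell;1,\ldots,1)=\frac1{\sqrt{2\pi}}\int_{-\infty}^\infty\prod_{j=1}^\ell\Phi\Bigl(\sqrt{\tfrac{\lambda_j}{\lambda_0}}\,x\Bigr)e^{-x^2/2}\,dx,$$ where for $\lambda_0<0$ the convention $\sqrt{\lambda_0}=i\sqrt{-\lambda_0}$ is used, i.e. $\sqrt{\lambda_j/\lambda_0}:=\sqrt{\lambda_j}/(i\sqrt{-\lambda_0})$.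
   Context: $[\ldots]$ denotes the convex hull. $\Phi:\mathbb C\to\mathbb C$, $\Phi(z)=\frac12+\frac1{\sqrt{2\pi}}\int_0^ze^{-x^2/2}\,dx$ (along any contour from $0$ to $z$). Empty products equal $1$. Angles: the solid angle of a polyhedral cone $C$ is $\alpha(C)=\mathbb P[\xi\in C]$ with $\xi$ a standard Gaussian vector on the linear hull of $C$. For a face $F$ of a polytope $P\subseteq\mathbb R^N$ and $x_0$ in the relative interior of $F$, the tangent cone is $T(F,P)=\{v\in\mathbb R^N: x_0+\varepsilon v\in P\text{ for some }\varepsilon>0\}$ and the normal cone is its polar $N(F,P)=\{v\in\mathbb R^N:\langle v,z-x_0\rangle\le0\text{ for all }z\in P\}$; $\beta(F,P):=\alpha(T(F,P))$ and $\gamma(F,P):=\alpha(N(F,P))$ are the internal and external angles. Function $\mathbf g_\ell$: for $\ell\in\mathbb N$, nonzero real $\lambda_0,\ldots,\lambda_\ell$ such that either (A) all are positive, or (B) exactly one is negative, all others are positive and $\lambda_0+\cdots+\lambda_\ell<0$, and for $\varepsilon_1,\ldots,\varepsilon_\ell\in\{\pm1\}$, $\mathbf g_\ell(\lambda_0;\lambda_1,\ldots,\lambda_\ell;\varepsilon_1,\ldots,\varepsilon_\ell):=\mathbb P[\varepsilon_1\eta_1\le0,\ldots,\varepsilon_\ell\eta_\ell\le0]$, where $(\eta_1,\ldots,\eta_\ell)$ is centered Gaussian with covariance matrix $\bigl(\frac1{\lambda_0}+\frac{\delta_{ij}}{\lambda_i}\bigr)_{i,j=1}^\ell$. Also $\mathbf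 g_0(\lambda_0):=1$ for all $\lambda_0\in\mathbb R$. *)

theory Defs
  imports "HOL-Probability.Probability" "HOL-Complex_Analysis.Complex_Analysis"
begin

definition gauss_Phi :: "complex \<Rightarrow> complex" where
  "gauss_Phi z = 1/2 + 1 / of_real (sqrt (2 * pi)) *
     contour_integral (linepath 0 z) (\<lambda>x. exp (- (x\<^sup>2) / 2))"

lemma gauss_Phi_any_contour:
  assumes "valid_path p" "pathstart p = 0" "pathfinish p = z"
  shows "gauss_Phi z = 1/2 + 1 / of_real (sqrt (2 * pi)) *
           contour_integral p (\<lambda>x. exp (- (x\<^sup>2) / 2))"
proof -
  have "(\<lambda>x::complex. exp (- (x\<^sup>2) / 2)) holomorphic_on UNIV"
    by (intro holomorphic_intros) auto
  then obtain G where G: "\<And>x::complex. (G has_field_derivative exp (- (x\<^sup>2) / 2)) (at x)"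
    by (metis holomorphic_convex_primitive' convex_UNIV open_UNIV UNIV_I)
  have "contour_integral q (\<lambda>x. exp (- (x\<^sup>2) / 2)) = G z - G 0"
    if "valid_path q" "pathstart q = 0" "pathfinish q = z" for q
    using contour_integral_primitive[of UNIV G "\<lambda>x. exp (- (x\<^sup>2) / 2)" q] G that
    by (auto intro!: contour_integral_unique)
  then show ?thesis
    using assms unfolding gauss_Phi_def by simp
qed

text \<open>The law of a standard Gaussian vector on a linear subspace \<open>L\<close>: the coordinates with
  respect to an orthonormal basis of \<open>L\<close> are independent and standard normal. By rotation
  invariance the law does not depend on the basis chosen.\<close>

definition orthonormal_basis_of :: "'a::euclidean_space set \<Rightarrow> 'a set \<Rightarrow> bool" where
  "orthonormal_basis_of L B \<longleftrightarrow> pairwise orthogonal B \<and> (\<forall>b\<in>B. norm b = 1) \<and> span B = L"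

definition std_gaussian_on :: "'a::euclidean_space set \<Rightarrow> 'a measure" where
  "std_gaussian_on L =
     (let B = (SOME B. orthonormal_basis_of L B)
      in distr (\<Pi>\<^sub>M b\<in>B. density lborel std_normal_density) borel (\<lambda>x. \<Sum>b\<in>B. x b *\<^sub>R b))"

definition solid_angle :: "'a::euclidean_space set \<Rightarrow> real" where
  "solid_angle C = measure (std_gaussian_on (span C)) C"

definition tangent_cone :: "'a::euclidean_space set \<Rightarrow> 'a set \<Rightarrow> 'a set" where
  "tangent_cone F P =
     (let x0 = (SOME x. x \<in> rel_interior F) in {v. \<exists>\<epsilon>>0. x0 + \<epsilon> *\<^sub>R v \<in> P})"

definition normal_cone :: "'a::euclidean_space set \<Rightarrow> 'a set \<Rightarrow> 'a set" where
  "normal_cone F P =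
     (let x0 = (SOME x. x \<in> rel_interior F) in {v. \<forall>z\<in>P. v \<bullet> (z - x0) \<le> 0})"

text \<open>Neither cone depends on the choice of the relative interior point.\<close>

lemma rel_interior_prolong:
  fixes F :: "'a::euclidean_space set"
  assumes "convex F" "x \<in> rel_interior F" "y \<in> rel_interior F"
  obtains w t where "w \<in> F" "0 < t" "t \<le> 1" "y = (1 - t) *\<^sub>R w + t *\<^sub>R x"
proof -
  have "x \<in> F"
    using assms rel_interior_subset by blast
  then obtain e where e: "e > 1" "(1 - e) *\<^sub>R x + e *\<^sub>R y \<in> F"
    using convex_rel_interior_iff[of F y] assms by blast
  let ?w = "(1 - e) *\<^sub>R x + e *\<^sub>R y"
  have "y = (1 - (1 - 1/e)) *\<^sub>R ?w + (1 - 1/e) *\<^sub>R x"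
    using e(1) by (simp add: scaleR_right_distrib algebra_simps)
  with e show thesis
    by (intro that[of ?w "1 - 1/e"]) auto
qed

lemma tangent_cone_eq:
  assumes "convex F" "convex P" "F \<subseteq> P" "x0 \<in> rel_interior F"
  shows "tangent_cone F P = {v. \<exists>\<epsilon>>0. x0 + \<epsilon> *\<^sub>R v \<in> P}"
proof -
  have *: "\<exists>\<epsilon>>0. y + \<epsilon> *\<^sub>R v \<in> P"
    if xy: "x \<in> rel_interior F" "y \<in> rel_interior F" and v: "\<exists>\<epsilon>>0. x + \<epsilon> *\<^sub>R v \<in> P" for x y v
  proof -
    obtain \<epsilon> where \<epsilon>: "\<epsilon> > 0" "x + \<epsilon> *\<^sub>R v \<in> P"
      using v by blast
    obtain w t where w: "w \<in> F" "0 < t" "t \<le> 1" "y = (1 - t) *\<^sub>R w + t *\<^sub>R x"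
      using rel_interior_prolong[OF assms(1) xy] by blast
    have "(1 - t) *\<^sub>R w + t *\<^sub>R (x + \<epsilon> *\<^sub>R v) \<in> P"
      using convexD[OF assms(2), of w "x + \<epsilon> *\<^sub>R v" "1 - t" t] w \<epsilon> assms(3) by auto
    moreover have "y + (t * \<epsilon>) *\<^sub>R v = (1 - t) *\<^sub>R w + t *\<^sub>R (x + \<epsilon> *\<^sub>R v)"
      by (subst w(4)) (simp add: scaleR_add_right)
    ultimately have "y + (t * \<epsilon>) *\<^sub>R v \<in> P"
      by simp
    then show ?thesis
      using w \<epsilon> by (intro exI[of _ "t * \<epsilon>"]) auto
  qed
  have "(SOME x. x \<in> rel_interior F) \<in> rel_interior F"
    using assms(4) by (rule someI)
  then show ?thesis
    unfolding tangent_cone_def Let_def using *[OF _ assms(4)] *[OF assms(4)] by blast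
qed

lemma normal_cone_eq:
  assumes "convex F" "F \<subseteq> P" "x0 \<in> rel_interior F"
  shows "normal_cone F P = {v. \<forall>z\<in>P. v \<bullet> (z - x0) \<le> 0}"
proof -
  have *: "v \<bullet> (z - y) \<le> 0"
    if xy: "x \<in> rel_interior F" "y \<in> rel_interior F"
      and v: "\<forall>z\<in>P. v \<bullet> (z - x) \<le> 0" and "z \<in> P" for x y v z
  proof -
    obtain w t where w: "w \<in> F" "0 < t" "t \<le> 1" "x = (1 - t) *\<^sub>R w + t *\<^sub>R y"
      using rel_interior_prolong[OF assms(1) xy(2,1)] by blast
    have "(1 - t) * (v \<bullet> w - v \<bullet> x) \<le> 0"
      using v w assms(2) by (intro mult_nonneg_nonpos) (auto simp: inner_diff_right)
    moreover have "v \<bullet> x = (1 - t) * (v \<bullet> w) + t * (v \<bullet> y)"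
      by (subst w(4)) (simp add: inner_add_right)
    ultimately have "t * (v \<bullet> x - v \<bullet> y) \<le> 0"
      unfolding left_diff_distrib right_diff_distrib mult_1 by linarith
    then have "v \<bullet> x \<le> v \<bullet> y"
      using w(2) by (simp add: mult_le_0_iff)
    moreover have "v \<bullet> z \<le> v \<bullet> x"
      using v \<open>z \<in> P\<close> by (auto simp: inner_diff_right)
    ultimately show ?thesis
      by (simp add: inner_diff_right)
  qed
  have "(SOME x. x \<in> rel_interior F) \<in> rel_interior F"
    using assms(3) by (rule someI)
  then show ?thesis
    unfolding normal_cone_def Let_def using *[OF _ assms(3)] *[OF assms(3)] by blast
qed

definition internal_angle :: "'a::euclidean_space set \<Rightarrow> 'a set \<Rightarrow> real" where
  "internal_angle F P = solid_angle (tangent_cone F P)"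

definition external_angle :: "'a::euclidean_space set \<Rightarrow> 'a set \<Rightarrow> real" where
  "external_angle F P = solid_angle (normal_cone F P)"

text \<open>\<open>M\<close> is the law of a centered Gaussian vector \<open>(\<eta>\<^sub>i)\<^sub>i\<^sub>\<in>\<^sub>I\<close> with covariance matrix \<open>C\<close>, specified by
  its characteristic function. Such a law is unique, and exists if \<open>C\<close> is symmetric
  positive semidefinite.\<close>

definition is_centered_gaussian ::
  "nat set \<Rightarrow> (nat \<Rightarrow> nat \<Rightarrow> real) \<Rightarrow> (nat \<Rightarrow> real) measure \<Rightarrow> bool" where
  "is_centered_gaussian I C M \<longleftrightarrow>
     prob_space M \<and> sets M = sets (\<Pi>\<^sub>M i\<in>I. (borel :: real measure)) \<and>
     (\<forall>t. (LINT x|M. iexp (\<Sum>i\<in>I. t i * x i)) =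
          of_real (exp (- (\<Sum>i\<in>I. \<Sum>j\<in>I. t i * t j * C i j) / 2)))"

definition centered_gaussian :: "nat set \<Rightarrow> (nat \<Rightarrow> nat \<Rightarrow> real) \<Rightarrow> (nat \<Rightarrow> real) measure" where
  "centered_gaussian I C = (THE M. is_centered_gaussian I C M)"

text \<open>Only meaningful for \<open>\<epsilon>\<^sub>j \<in> {-1, 1}\<close> and nonzero \<open>\<lambda>\<^sub>0, \<dots>, \<lambda>\<^sub>l\<close> which are either all positive, or
  have exactly one negative entry and a negative sum; then the covariance matrix is positive
  definite.\<close>

definition g_fun :: "nat \<Rightarrow> real \<Rightarrow> (nat \<Rightarrow> real) \<Rightarrow> (nat \<Rightarrow> real) \<Rightarrow> real" where
  "g_fun l lam0 lam \<epsilon> =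
     (if l = 0 then 1
      else let M = centered_gaussian {1..l} (\<lambda>i j. 1 / lam0 + (if i = j then 1 / lam i else 0))
           in measure M {\<eta> \<in> space M. \<forall>j\<in>{1..l}. \<epsilon> j * \<eta> j \<le> 0})"

text \<open>The square root of \<open>a / b\<close> for \<open>a > 0\<close> and \<open>b \<noteq> 0\<close>, with \<open>sqrt b = \<i> * sqrt (- b)\<close> for \<open>b < 0\<close>.\<close>

definition sqrt_ratio :: "real \<Rightarrow> real \<Rightarrow> complex" where
  "sqrt_ratio a b =
     (if b > 0 then of_real (sqrt (a / b))
      else of_real (sqrt a) / (\<i> * of_real (sqrt (- b))))"

end

(* A Gaussian law on a finite product of real lines is determined by its characteristic function,
   so centered_gaussian may be replaced by any explicit model. For lambda_0 > 0 the model is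
   eta_j = Y_j / sqrt lambda_j - Z / sqrt lambda_0 with independent standard normal Y_j and Z, and
   conditioning on Z yields the integral formula. For lambda_0 < 0 put
   s = -(lambda_0 + lambda_1 + ... + lambda_l) > 0. By the Sherman-Morrison formula the inverse
   covariance matrix is diag(lambda) + lambda lambda^T / s, and the rank-one factor of the density
   is linearised by exp(-q^2/2) = E exp(i q Z); Fubini's theorem again leaves a product of
   one-dimensional integrals, which are values of Phi on the imaginary axis.
   Finally, the tangent and the normal cone of the simplex are each cut out of their linear hull L
   by l = d - k half-spaces {v. w_j . v <= 0} with w_j in L, and the Gram matrix of the w_j is the
   covariance matrix in the definition of g_l. *)

theory Submission
  imports Defs "HOL-Real_Asymp.Real_Asymp"
begin

subsection \<open>Uniqueness of characteristic functions on finite products\<close>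

text \<open>The two angles differ by a sign. Up to sign, the normals of the half-spaces are the
  vertices e_i/\<tau>_i with i > k, corrected by a multiple of a vector T, the sum of \<tau>_i e_i
  over all i or over i <= k. For the tangent cone the component along T is projected away, which
  lowers every Gram entry by 1/|T|^2. For the normal cone a component orthogonal to these e_i is
  added, which raises every entry by 1/|T|^2. This is the origin of the negative and of the positive
  lambda_0. The obstacle is the negative case: a common negative term in the covariance matrix
  cannot come from an independent noise added to all coordinates, so a product law has to be
  reweighted instead of shifted. The auxiliary Z then enters only through a phase, and the
  one-dimensional integrals that remain are truncated characteristic functions
  E[1(Y <= b) exp(iuY)]; this is where \<Phi> leaves the real line. There it grows like exp(u^2/2),
  and s > 0 is what lets the Gaussian weight dominate the product of these growth factors.\<close>

text \<open>The frequency 0 shows that both measures have the same total mass; unless it vanishes,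
  dividing by it reduces the claim to Levy's uniqueness theorem for probability laws. Finite
  measures are needed because the lemma is applied to weighted laws.\<close>

lemma finite_measure_eqI_iexp:
  fixes M N :: "real measure"
  assumes "finite_measure M" "finite_measure N" "sets M = sets borel" "sets N = sets borel"
    and eq: "\<And>t. (LINT x|M. iexp (t * x)) = (LINT x|N. iexp (t * x))"
  shows "M = N"
proof -
  interpret M: finite_measure M by fact
  interpret N: finite_measure N by fact
  note [measurable_cong] = assms(3,4)
  have sp: "space M = UNIV" "space N = UNIV"
    using sets_eq_imp_space_eq[OF assms(3)] sets_eq_imp_space_eq[OF assms(4)] by simp_all
  have "complex_of_real (measure M UNIV) = complex_of_real (measure N UNIV)"
    using eq[of 0] sp by simp
  then have mass: "measure N UNIV = measure M UNIV"
    by simp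
  show ?thesis
  proof (cases "measure M UNIV = 0")
    case True
    then have "emeasure M A = 0 \<and> emeasure N A = 0" for A
      using mass M.finite_measure_mono[of A UNIV] N.finite_measure_mono[of A UNIV] sp sets.top[of M] sets.top[of N]
      by (simp add: M.emeasure_eq_measure N.emeasure_eq_measure)
         (smt (verit) measure_nonneg)
    then show ?thesis
      using assms by (intro measure_eqI) auto
  next
    case False
    define m where "m = measure M UNIV"
    have m: "m > 0"
      using False by (simp add: m_def zero_less_measure_iff)
    have prob: "real_distribution (density K (\<lambda>_. ennreal (1 / m)))"
      if "finite_measure K" "sets K = sets borel" "measure K UNIV = m" for K
    proof -
      interpret K: finite_measure K by fact
      have "space K = UNIV"
        using sets_eq_imp_space_eq[OF that(2)] by simp
      then have "emeasure (density K (\<lambda>_. ennreal (1 / m))) (space K) = 1"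
        using m that(2,3) by (simp add: emeasure_density K.emeasure_eq_measure flip: ennreal_mult)
      then have "prob_space (density K (\<lambda>_. ennreal (1 / m)))"
        by (intro prob_spaceI) simp
      then show ?thesis
        using that \<open>space K = UNIV\<close>
        by (simp add: real_distribution_def real_distribution_axioms_def)
    qed
    have "char (density M (\<lambda>_. ennreal (1 / m))) = char (density N (\<lambda>_. ennreal (1 / m)))"
      using m eq by (intro ext) (simp add: char_def integral_density)
    then have "density M (\<lambda>_. ennreal (1 / m)) = density N (\<lambda>_. ennreal (1 / m))"
      using prob[of M] prob[of N] assms mass by (intro Levy_uniqueness) (auto simp: m_def)
    then have *: "emeasure (density M (\<lambda>_. ennreal (1 / m))) A = emeasure (density N (\<lambda>_. ennreal (1 / m))) A" for A
      by simp
    have "measure M A = measure N A" if "A \<in> sets borel" for A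
      using *[of A] that m by (simp add: emeasure_density M.emeasure_eq_measure N.emeasure_eq_measure
          nn_integral_cmult_indicator assms flip: ennreal_mult)
    then show ?thesis
      using assms by (intro measure_eqI) (auto simp: M.emeasure_eq_measure N.emeasure_eq_measure)
  qed
qed

text \<open>The hypothesis says that the images under \<open>X\<close> of the measures with density
  \<open>W\<close> have the same characteristic function. The bound \<open>c\<close> makes these
  images finite measures.\<close>

lemma integral_indicator_eqI_iexp:
  fixes W X :: "'b \<Rightarrow> real"
  assumes "finite_measure M" "finite_measure N" and sets_eq: "sets M = sets N"
    and [measurable]: "W \<in> borel_measurable M" "X \<in> borel_measurable M" "A \<in> sets borel"
    and W: "\<And>x. 0 \<le> W x" "\<And>x. W x \<le> c"
    and eq: "\<And>s. (LINT x|M. W x * iexp (s * X x)) = (LINT x|N. W x * iexp (s * X x))"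
  shows "(LINT x|M. W x * indicat_real A (X x)) = (LINT x|N. W x * indicat_real A (X x))"
proof -
  have [measurable]: "W \<in> borel_measurable N" "X \<in> borel_measurable N"
    using assms(4,5) unfolding measurable_cong_sets[OF sets_eq refl] by auto
  define D where "D K = distr (density K (\<lambda>x. ennreal (W x))) borel X" for K
  have fin: "finite_measure (D K)"
    if "finite_measure K" and [measurable]: "W \<in> borel_measurable K" "X \<in> borel_measurable K" for K
  proof -
    interpret K: finite_measure K by fact
    have "integrable K W"
      using W by (intro K.integrable_const_bound[where B = c]) auto
    then have "emeasure (density K (\<lambda>x. ennreal (W x))) (space K) \<noteq> \<infinity>"
      using W by (simp add: emeasure_density nn_integral_eq_integral cong: nn_integral_cong)
    then show ?thesis
      unfolding D_def by (intro finite_measure.finite_measure_distr finite_measureI) auto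
  qed
  have int: "(LINT y|D K. f y) = (LINT x|K. W x *\<^sub>R f (X x))"
    if [measurable]: "W \<in> borel_measurable K" "X \<in> borel_measurable K" "f \<in> borel_measurable borel"
    for K and f :: "real \<Rightarrow> 'c::{banach, second_countable_topology}"
    using W unfolding D_def by (simp add: integral_distr integral_density)
  have "D M = D N"
  proof (rule finite_measure_eqI_iexp)
    show "finite_measure (D M)" "finite_measure (D N)"
      using fin assms by auto
    show "sets (D M) = sets borel" "sets (D N) = sets borel"
      by (auto simp: D_def)
    show "(LINT x|D M. iexp (t * x)) = (LINT x|D N. iexp (t * x))" for t
      using eq[of t] by (simp add: int scaleR_conv_of_real)
  qed
  then show ?thesis
    using int[of M "indicat_real A"] int[of N "indicat_real A"] by simp
qed

text \<open>The factors \<open>iexp (t i * x i)\<close> are traded for indicators of Borel sets one coordinate at a time: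
  the one-dimensional theorem applies to the \<open>k\<close>-th coordinate under the nonnegative density
  \<open>P J A x * (1 + cos (T x + \<theta>))\<close>, and \<open>\<theta> = 0\<close>, \<open>\<theta> = - pi / 2\<close> recover the real and imaginary parts.\<close>

lemma measure_eqI_PiM_iexp:
  fixes M N :: "('i \<Rightarrow> real) measure"
  assumes I: "finite I" and "finite_measure M" "finite_measure N"
    and sets_M: "sets M = sets (\<Pi>\<^sub>M i\<in>I. (borel :: real measure))"
    and sets_N: "sets N = sets (\<Pi>\<^sub>M i\<in>I. (borel :: real measure))"
    and eq: "\<And>t. (LINT x|M. iexp (\<Sum>i\<in>I. t i * x i)) = (LINT x|N. iexp (\<Sum>i\<in>I. t i * x i))"
  shows "M = N"
proof -
  interpret M: finite_measure M by fact
  interpret N: finite_measure N by fact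
  note [measurable_cong] = sets_M sets_N
  define P where "P J A x = (\<Prod>j\<in>J. indicat_real (A j) (x j))"
    for J :: "'i set" and A :: "'i \<Rightarrow> real set" and x :: "'i \<Rightarrow> real"
  have P01: "0 \<le> P J A x" "P J A x \<le> 1" for J A x
    by (auto simp: P_def prod_nonneg intro!: prod_le_1)
  have P_meas: "P J A \<in> borel_measurable K"
    if "J \<subseteq> I" "\<And>j. A j \<in> sets borel" and [measurable_cong]: "sets K = sets (\<Pi>\<^sub>M i\<in>I. (borel :: real measure))"
    for J A K
  proof -
    have "(\<lambda>x. indicat_real (A j) (x j)) \<in> borel_measurable K" if "j \<in> J" for j
      proof -
      have [measurable]: "j \<in> I" using that \<open>J \<subseteq> I\<close> by auto
      note [measurable] = \<open>\<And>j. A j \<in> sets borel\<close>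
      show ?thesis by measurable
    qed
    then show ?thesis
      unfolding P_def by (intro borel_measurable_prod) auto
  qed
  have main: "(LINT x|M. P J A x * iexp (\<Sum>i\<in>I. t i * x i)) = (LINT x|N. P J A x * iexp (\<Sum>i\<in>I. t i * x i))"
    if "finite J" "J \<subseteq> I" "\<And>j. A j \<in> sets borel" for J A t
    using that
  proof (induction J arbitrary: t rule: finite_induct)
    case empty
    then show ?case using eq by (simp add: P_def)
  next
    case (insert k J)
    have k: "k \<in> I" and J: "J \<subseteq> I" using insert by auto
    note [measurable] = P_meas[OF J insert.prems(2)] k insert.prems(2)
    define T where "T x = (\<Sum>i\<in>I. t i * x i)" for x
    have [measurable]: "T \<in> borel_measurable M" "T \<in> borel_measurable N"
      unfolding T_def by measurable
    have integ: "integrable K (\<lambda>x. P J A x * iexp (\<Sum>i\<in>I. u i * x i))"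
      if "finite_measure K" and [measurable_cong]: "sets K = sets (\<Pi>\<^sub>M i\<in>I. (borel :: real measure))" for K u
    proof -
      interpret K: finite_measure K by fact
      have [measurable]: "P J A \<in> borel_measurable K" using P_meas[OF J insert.prems(2)] that by auto
      show ?thesis
        using P01 by (intro K.integrable_const_bound[where B = 1]) (auto simp: norm_mult)
    qed
    \<comment> \<open>Frequencies \<open>a * t\<close> with an extra \<open>s\<close> at index
      \<open>k\<close> are again admissible frequencies, so the induction hypothesis, stated for all
      \<open>t\<close>, already contains the integrals with \<open>iexp (s * x k)\<close>.\<close>
    have shift: "(\<Sum>i\<in>I. (a * t i + (if i = k then s else 0)) * x i) = a * T x + s * x k" for a s x
      using k I by (simp add: T_def distrib_right sum.distrib sum_distrib_left if_distrib[of "\<lambda>c. c * _"]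
          sum.delta mult.assoc cong: if_cong)
    have int: "integrable K (\<lambda>x. P J A x * iexp (a * T x + s * x k))"
      if "finite_measure K" "sets K = sets (\<Pi>\<^sub>M i\<in>I. (borel :: real measure))" for K a s
      using integ[OF that, of "\<lambda>i. a * t i + (if i = k then s else 0)"] unfolding shift .
    have IH: "(LINT x|M. P J A x * iexp (a * T x + s * x k)) = (LINT x|N. P J A x * iexp (a * T x + s * x k))" for a s
      using insert.IH[OF J insert.prems(2), of "\<lambda>i. a * t i + (if i = k then s else 0)"] unfolding shift .
    have slice: "(LINT x|M. (P J A x * (1 + cos (T x + \<theta>))) * indicat_real (A k) (x k))
               = (LINT x|N. (P J A x * (1 + cos (T x + \<theta>))) * indicat_real (A k) (x k))" for \<theta>
    proof (rule integral_indicator_eqI_iexp[where c = 2])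
      fix x
      show "0 \<le> P J A x * (1 + cos (T x + \<theta>))"
        using P01[of J A x] cos_ge_minus_one[of "T x + \<theta>"] by (intro mult_nonneg_nonneg) (auto simp del: cos_ge_minus_one)
      show "P J A x * (1 + cos (T x + \<theta>)) \<le> 2"
        using mult_mono[OF P01(2)[of J A x], of "1 + cos (T x + \<theta>)" 2] P01[of J A x] cos_ge_minus_one[of "T x + \<theta>"]
          cos_le_one[of "T x + \<theta>"] by linarith
    next
      fix s
      have comb: "(LINT x|K. f x + c * g x + b * h x) = integral\<^sup>L K f + c * integral\<^sup>L K g + b * integral\<^sup>L K h"
        if "integrable K f" "integrable K g" "integrable K h"
        for K :: "('i \<Rightarrow> real) measure" and f g h :: "('i \<Rightarrow> real) \<Rightarrow> complex" and b c
        using that by simp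
      \<comment> \<open>Euler's formula for the cosine leaves three exponentials, with
        \<open>a\<close> equal to 0, 1 and -1, and \<open>IH\<close> covers each of them.\<close>
      have split: "complex_of_real (P J A x * (1 + cos (T x + \<theta>))) * iexp (s * x k)
        = P J A x * iexp (0 * T x + s * x k) + (iexp \<theta> / 2) * (P J A x * iexp (1 * T x + s * x k))
          + (iexp (- \<theta>) / 2) * (P J A x * iexp ((- 1) * T x + s * x k))" for x
      proof -
        have "complex_of_real (cos (T x + \<theta>)) = (iexp (T x + \<theta>) + iexp (- (T x + \<theta>))) / 2"
          by (simp add: cos_exp_eq algebra_simps flip: cos_of_real)
        then show ?thesis
          unfolding of_real_mult[of "P J A x"] of_real_add[of 1] of_real_1
          by (simp only:) (simp add: ring_distribs exp_add exp_diff exp_minus field_simps)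
      qed
      show "(LINT x|M. complex_of_real (P J A x * (1 + cos (T x + \<theta>))) * iexp (s * x k))
         = (LINT x|N. complex_of_real (P J A x * (1 + cos (T x + \<theta>))) * iexp (s * x k))"
        unfolding split
        using int[OF assms(2) sets_M] int[OF assms(3) sets_N]
        by (simp only: comb IH)
    qed (use assms sets_M sets_N in auto)
    have slice0: "(LINT x|M. P J A x * indicat_real (A k) (x k)) = (LINT x|N. P J A x * indicat_real (A k) (x k))"
      using IH[of 0] P01
      by (intro integral_indicator_eqI_iexp[where c = 1]) (use assms sets_M sets_N in auto)
    have PI: "P (insert k J) A x = P J A x * indicat_real (A k) (x k)" for x
      using insert.hyps by (simp add: P_def)
    have intr: "integrable K (\<lambda>x. P J A x * f (T x) * indicat_real (A k) (x k))"
      if "finite_measure K" and [measurable_cong]: "sets K = sets (\<Pi>\<^sub>M i\<in>I. (borel :: real measure))"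
        and [measurable]: "f \<in> borel_measurable borel" and f: "\<And>x. \<bar>f x\<bar> \<le> 1" for K and f :: "real \<Rightarrow> real"
    proof -
      interpret K: finite_measure K by fact
      have [measurable]: "P J A \<in> borel_measurable K" using P_meas[OF J insert.prems(2)] that by auto
      have [measurable]: "T \<in> borel_measurable K"
        unfolding T_def by measurable
      have "\<bar>P J A x * f (T x) * indicat_real (A k) (x k)\<bar> \<le> 1" for x
        using mult_mono[OF P01(2)[of J A x] f[of "T x"]] P01[of J A x] by (auto simp: abs_mult indicator_def)
      then show ?thesis
        by (intro K.integrable_const_bound[where B = 1]) auto
    qed
    have cs: "(LINT x|M. P J A x * cos (T x + \<theta>) * indicat_real (A k) (x k))
           = (LINT x|N. P J A x * cos (T x + \<theta>) * indicat_real (A k) (x k))" for \<theta>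
    proof -
      have "(LINT x|K. (P J A x * (1 + cos (T x + \<theta>))) * indicat_real (A k) (x k))
        = (LINT x|K. P J A x * indicat_real (A k) (x k)) + (LINT x|K. P J A x * cos (T x + \<theta>) * indicat_real (A k) (x k))"
        if "finite_measure K" "sets K = sets (\<Pi>\<^sub>M i\<in>I. (borel :: real measure))" for K
        using intr[OF that, of "\<lambda>_. 1"] intr[OF that, of "\<lambda>x. cos (x + \<theta>)"]
        by (subst Bochner_Integration.integral_add[symmetric]) (auto simp: algebra_simps)
      from this[OF assms(2) sets_M] this[OF assms(3) sets_N] show ?thesis
        using slice[of \<theta>] slice0 by simp
    qed
    have sum: "(LINT x|K. P (insert k J) A x * iexp (T x))
        = complex_of_real (LINT x|K. P J A x * cos (T x + 0) * indicat_real (A k) (x k)) +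
          \<i> * complex_of_real (LINT x|K. P J A x * cos (T x + - (pi/2)) * indicat_real (A k) (x k))"
      if "finite_measure K" "sets K = sets (\<Pi>\<^sub>M i\<in>I. (borel :: real measure))" for K
    proof -
      have pt: "complex_of_real (P (insert k J) A x) * iexp (T x)
        = complex_of_real (P J A x * cos (T x + 0) * indicat_real (A k) (x k)) +
          \<i> * complex_of_real (P J A x * cos (T x + - (pi/2)) * indicat_real (A k) (x k))" for x
      proof -
        have "cos (T x + - (pi/2)) = sin (T x)"
          by (simp add: cos_diff)
        then show ?thesis
          by (simp add: PI exp_Euler cos_of_real sin_of_real algebra_simps)
      qed
      have cx: "(LINT x|K. complex_of_real (f x) + \<i> * complex_of_real (g x))
          = complex_of_real (integral\<^sup>L K f) + \<i> * complex_of_real (integral\<^sup>L K g)"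
        if "integrable K f" "integrable K g" for f g
        using that by simp
      show ?thesis
        unfolding pt by (intro cx intr[OF that, where f = "\<lambda>x. cos (x + _)"]) auto
    qed
    show ?case
      using sum[OF assms(2) sets_M] sum[OF assms(3) sets_N] cs[of 0] cs[of "- (pi/2)"]
      unfolding T_def by simp
  qed
  show ?thesis
  proof (rule measure_eqI_PiM_finite[where A = "\<lambda>_. space (\<Pi>\<^sub>M i\<in>I. (borel :: real measure))"])
    fix A :: "'i \<Rightarrow> real set" assume A: "\<And>i. i \<in> I \<Longrightarrow> A i \<in> sets borel"
    \<comment> \<open>\<open>main\<close> asks for Borel sets at every index, while \<open>A\<close>
      is controlled only on \<open>I\<close>.\<close>
    define A' where "A' i = (if i \<in> I then A i else {})" for i
    have A': "A' j \<in> sets borel" for j using A by (auto simp: A'_def)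
    have eqset: "Pi\<^sub>E I A = Pi\<^sub>E I A'" by (auto simp: A'_def PiE_iff)
    have *: "(LINT x|K. P I A' x) = measure K (Pi\<^sub>E I A)" if K: "sets K = sets (\<Pi>\<^sub>M i\<in>I. (borel :: real measure))" for K
    proof -
      have sp: "space K = (\<Pi>\<^sub>E i\<in>I. UNIV)"
        using sets_eq_imp_space_eq[OF K] by (simp add: space_PiM)
      have "P I A' x = indicat_real (Pi\<^sub>E I A) x" if "x \<in> space K" for x
        using that I unfolding sp eqset by (auto simp: P_def indicator_def PiE_iff)
      then have "(LINT x|K. P I A' x) = (LINT x|K. indicat_real (Pi\<^sub>E I A) x)"
        by (intro Bochner_Integration.integral_cong) auto
      moreover have "Pi\<^sub>E I A \<in> sets K"
        unfolding K using A I by (intro sets_PiM_I_finite) auto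
      ultimately show ?thesis
        using sets.sets_into_space by (auto simp: Int_absorb2)
    qed
    have "complex_of_real (LINT x|M. P I A' x) = complex_of_real (LINT x|N. P I A' x)"
      using main[OF I subset_refl A', where t = "\<lambda>_. 0"] by simp
    then show "emeasure M (Pi\<^sub>E I A) = emeasure N (Pi\<^sub>E I A)"
      using *[OF sets_M] *[OF sets_N] by (simp add: M.emeasure_eq_measure N.emeasure_eq_measure)
  next
    show "range (\<lambda>_::nat. space (\<Pi>\<^sub>M i\<in>I. (borel :: real measure))) \<subseteq> prod_algebra I (\<lambda>_. borel)"
      using I by (auto simp: space_PiM intro!: prod_algebraI_finite)
  qed (use assms in auto)
qed

subsection \<open>One-dimensional Gaussian integrals\<close>

abbreviation gauss :: "real measure" where
  "gauss \<equiv> std_normal_distribution"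

lemma prob_space_gauss: "prob_space gauss"
  by (rule prob_space_normal_density) simp

lemma integral_gauss:
  fixes f :: "real \<Rightarrow> 'b::{banach, second_countable_topology}"
  assumes "f \<in> borel_measurable borel"
  shows "(LINT x|gauss. f x) = (LINT x|lborel. std_normal_density x *\<^sub>R f x)"
  using assms by (intro integral_density) auto

lemma integrable_exp_neg_half_square:
  assumes "a > 0"
  shows "integrable lborel (\<lambda>x::real. exp (- a * x\<^sup>2 / 2))"
proof -
  have "exp (- a * x\<^sup>2 / 2) = sqrt (2 * pi / a) * normal_density 0 (1 / sqrt a) x" for x
    using assms by (simp add: normal_density_def real_sqrt_divide real_sqrt_mult field_simps)
  then show ?thesis
    using assms by (simp only:) (intro integrable_mult_right integrable_normal_density, auto)
qed

text \<open>Completing the square turns the integrand into a multiple of the normal density with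
  mean -b/(1+a) and variance 1/(1+a).\<close>

lemma integral_gauss_exp_quadratic:
  assumes "1 + a > 0"
  shows "(LINT z|gauss. exp (- (a * z\<^sup>2 / 2 + b * z))) = exp (b\<^sup>2 / (2 * (1 + a))) / sqrt (1 + a)"
proof -
  define m where "m = - b / (1 + a)"
  define C where "C = exp (b\<^sup>2 / (2 * (1 + a))) / sqrt (1 + a)"
  have *: "std_normal_density z * exp (- (a * z\<^sup>2 / 2 + b * z)) = C * normal_density m (1 / sqrt (1 + a)) z" for z
  proof -
    have "c * (z + b / c)\<^sup>2 = c * z\<^sup>2 + 2 * b * z + b\<^sup>2 / c" if "c > 0" for c
      using that by (simp add: field_simps power2_eq_square)
    then have "(1 + a) * (z - m)\<^sup>2 = (1 + a) * z\<^sup>2 + 2 * b * z + b\<^sup>2 / (1 + a)"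
      using assms by (simp add: m_def)
    moreover have "b\<^sup>2 / (2 * (1 + a)) = (b\<^sup>2 / (1 + a)) / 2"
      by simp
    moreover have "- (1 + a) * (z - m)\<^sup>2 / 2 = - ((1 + a) * (z - m)\<^sup>2) / 2"
      by (simp only: minus_mult_left)
    ultimately have "- z\<^sup>2 / 2 + - (a * z\<^sup>2 / 2 + b * z) = b\<^sup>2 / (2 * (1 + a)) + - (1 + a) * (z - m)\<^sup>2 / 2"
      by (simp only: minus_add_distrib distrib_right add_divide_distrib mult_1)
    then have "exp (- z\<^sup>2 / 2) * exp (- (a * z\<^sup>2 / 2 + b * z)) = exp (b\<^sup>2 / (2 * (1 + a))) * exp (- (1 + a) * (z - m)\<^sup>2 / 2)"
      by (simp flip: exp_add)
    moreover have "sqrt (2 * pi * (1 / sqrt (1 + a))\<^sup>2) = sqrt (2 * pi) / sqrt (1 + a)"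
      using assms by (simp add: real_sqrt_divide power_divide)
    moreover have "- (z - m)\<^sup>2 / (2 * (1 / sqrt (1 + a))\<^sup>2) = - (1 + a) * (z - m)\<^sup>2 / 2"
      using assms by (simp add: power_divide algebra_simps)
    ultimately show ?thesis
      using assms unfolding C_def normal_density_def by (simp add: field_simps)
  qed
  have pos: "0 < 1 / sqrt (1 + a)" using assms by simp
  show "(LINT z|gauss. exp (- (a * z\<^sup>2 / 2 + b * z))) = C"
    using pos by (subst integral_gauss) (simp_all only: real_scaleR_def *, simp_all)
qed

section \<open>The function \<Phi> at complex arguments and truncated Gaussian characteristic
  functions\<close>

lemma gauss_Phi_has_field_derivative:
  "(gauss_Phi has_field_derivative exp (- (z\<^sup>2) / 2) / of_real (sqrt (2 * pi))) (at z)"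
proof -
  have "(\<lambda>x::complex. exp (- (x\<^sup>2) / 2)) holomorphic_on UNIV"
    by (intro holomorphic_intros) auto
  then obtain G where G: "\<And>x::complex. (G has_field_derivative exp (- (x\<^sup>2) / 2)) (at x)"
    by (metis holomorphic_convex_primitive' convex_UNIV open_UNIV UNIV_I)
  have "contour_integral (linepath 0 z) (\<lambda>x. exp (- (x\<^sup>2) / 2)) = G z - G 0" for z
    using contour_integral_primitive[of UNIV G "\<lambda>x. exp (- (x\<^sup>2) / 2)" "linepath 0 z"] G
    by (auto intro!: contour_integral_unique)
  then have *: "gauss_Phi = (\<lambda>z. 1/2 + 1 / of_real (sqrt (2 * pi)) * (G z - G 0))"
    by (simp add: gauss_Phi_def fun_eq_iff)
  show ?thesis
    unfolding * by (rule derivative_eq_intros G refl | simp)+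
qed

lemma gauss_Phi_0: "gauss_Phi 0 = 1 / 2"
  by (simp add: gauss_Phi_def)

lemma continuous_on_gauss_Phi: "continuous_on A gauss_Phi"
  by (meson DERIV_continuous continuous_at_imp_continuous_on gauss_Phi_has_field_derivative)

text \<open>By symmetry both half-lines have equal mass. Together with \<Phi>(0) = 1/2 this value
  forces \<Phi> to vanish at minus infinity.\<close>

lemma integral_gauss_atMost_0: "(LINT y|gauss. indicat_real {..0} y) = 1 / 2"
proof -
  interpret prob_space gauss by (rule prob_space_gauss)
  have sym: "measure gauss {..0} = measure gauss {0..}"
  proof -
    have "measure gauss {..0} = (LINT x|lborel. std_normal_density x * indicator {..0} x)"
      using integral_gauss[of "indicat_real {..0}"] by simp
    also have "\<dots> = (LINT x|lborel. std_normal_density (- x) * indicator {..0} (- x))"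
      by (subst lborel_integral_real_affine[where c = "- 1" and t = 0]) auto
    also have "\<dots> = (LINT x|lborel. std_normal_density x * indicator {0..} x)"
      by (intro Bochner_Integration.integral_cong) (auto simp: std_normal_density_def indicator_def)
    also have "\<dots> = measure gauss {0..}"
      using integral_gauss[of "indicat_real {0..}"] by simp
    finally show ?thesis .
  qed
  have "measure gauss {0} = 0"
    by (simp add: measure_def emeasure_density nn_integral_indicator_singleton)
  moreover have "measure gauss ({..0} \<union> {0..}) = measure gauss {..0} + measure gauss ({0..} - {0})"
    by (subst finite_measure_Union[symmetric]) (auto intro!: arg_cong[where f = "measure gauss"])
  moreover have "measure gauss ({0..} - {0}) = measure gauss {0..} - measure gauss {0}"
    by (intro finite_measure_Diff) auto
  moreover have "{..0} \<union> {0..} = (UNIV :: real set)"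
    by auto
  moreover have "measure gauss UNIV = 1"
    using prob_space by simp
  ultimately have "measure gauss {..0} = 1 / 2"
    using sym by simp
  then show ?thesis by simp
qed

text \<open>The phase is an imaginary shift of the argument: exp(-u^2/2) exp(-(y-iu)^2/2) =
  exp(-y^2/2) exp(iuy). Hence \<Phi>(y-iu), scaled by exp(-u^2/2), is a primitive of the integrand
  along the real line.\<close>

lemma integral_gauss_Icc_iexp:
  assumes "a \<le> b"
  shows "(LINT y|gauss. indicat_real {a..b} y * iexp (u * y))
     = of_real (exp (- u\<^sup>2 / 2)) * (gauss_Phi (of_real b - \<i> * of_real u) - gauss_Phi (of_real a - \<i> * of_real u))"
proof -
  define f where "f y = std_normal_density y * iexp (u * y)" for y
  define G where "G y = of_real (exp (- u\<^sup>2 / 2)) * gauss_Phi (of_real y - \<i> * of_real u)" for y :: real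
  have der: "(G has_vector_derivative f y) (at y within A)" for y A
  proof -
    have "((\<lambda>z. z - \<i> * of_real u) has_field_derivative 1) (at (of_real y))"
      by (auto intro!: derivative_eq_intros)
    then have "((\<lambda>z. of_real (exp (- u\<^sup>2 / 2)) * gauss_Phi (z - \<i> * of_real u)) has_field_derivative
      of_real (exp (- u\<^sup>2 / 2)) * (exp (- ((of_real y - \<i> * of_real u)\<^sup>2) / 2) / of_real (sqrt (2 * pi)) * 1)) (at (of_real y))"
      by (intro DERIV_cmult DERIV_chain2[OF gauss_Phi_has_field_derivative])
    then have "(G has_vector_derivative
      of_real (exp (- u\<^sup>2 / 2)) * (exp (- ((of_real y - \<i> * of_real u)\<^sup>2) / 2) / of_real (sqrt (2 * pi)) * 1)) (at y within A)"
      unfolding G_def by (rule has_vector_derivative_real_field)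
    moreover have "of_real (exp (- u\<^sup>2 / 2)) * exp (- ((of_real y - \<i> * of_real u)\<^sup>2) / 2)
        = of_real (exp (- y\<^sup>2 / 2)) * iexp (u * y)"
    proof -
      have "(of_real (- u\<^sup>2 / 2) :: complex) + - ((of_real y - \<i> * of_real u)\<^sup>2) / 2 = of_real (- y\<^sup>2 / 2) + \<i> * of_real (u * y)"
        by (simp add: power2_eq_square field_simps)
      then show ?thesis
        by (simp only: exp_of_real[symmetric] exp_add[symmetric])
    qed
    ultimately show ?thesis
      unfolding f_def by (simp add: std_normal_density_def)
  qed
  have "(LINT y|gauss. indicat_real {a..b} y * iexp (u * y)) = (LINT y|lborel. indicator {a..b} y *\<^sub>R f y)"
    by (subst integral_gauss) (auto simp: f_def scaleR_conv_of_real intro!: Bochner_Integration.integral_cong)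
  also have "\<dots> = G b - G a"
    using assms der unfolding f_def
    by (intro integral_FTC_atLeastAtMost continuous_intros) (auto simp: normal_density_def intro!: continuous_intros)
  finally show ?thesis
    by (simp add: G_def algebra_simps)
qed

text \<open>The lower end of the interval is sent to minus infinity. What has to be shown is
  \<Phi>(-n-iu) -> 0: on the real axis this is a statement about masses, and the vertical shift by u
  changes the value by a vanishing amount.\<close>

lemma integral_gauss_atMost_iexp:
  "(LINT y|gauss. indicat_real {..b} y * iexp (u * y))
     = of_real (exp (- u\<^sup>2 / 2)) * gauss_Phi (of_real b - \<i> * of_real u)"
proof -
  interpret prob_space gauss by (rule prob_space_gauss)
  have lim: "(\<lambda>n. of_real (exp (- u\<^sup>2 / 2)) * (gauss_Phi (of_real b - \<i> * of_real u) - gauss_Phi (of_real (- real n) - \<i> * of_real u)))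
     \<longlonglongrightarrow> (LINT y|gauss. indicat_real {..b} y * iexp (u * y))" for b u
  proof -
    have "(\<lambda>n. LINT y|gauss. indicat_real {- real n..b} y * iexp (u * y)) \<longlonglongrightarrow> (LINT y|gauss. indicat_real {..b} y * iexp (u * y))"
    proof (rule integral_dominated_convergence[where w = "\<lambda>_. 1"])
      show "AE y in gauss. (\<lambda>n. complex_of_real (indicat_real {- real n..b} y) * iexp (u * y)) \<longlonglongrightarrow>
          complex_of_real (indicat_real {..b} y) * iexp (u * y)"
      proof (intro AE_I2 tendsto_eventually)
        fix y
        obtain n0 where "- y \<le> real n0" using real_arch_simple by blast
        then show "\<forall>\<^sub>F n in sequentially. complex_of_real (indicat_real {- real n..b} y) * iexp (u * y)
            = complex_of_real (indicat_real {..b} y) * iexp (u * y)"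
          by (intro eventually_sequentiallyI[of n0]) (auto simp: indicator_def)
      qed
    qed (auto simp: norm_mult indicator_def)
    moreover have "\<forall>\<^sub>F n in sequentially. (LINT y|gauss. indicat_real {- real n..b} y * iexp (u * y)) =
      of_real (exp (- u\<^sup>2 / 2)) * (gauss_Phi (of_real b - \<i> * of_real u) - gauss_Phi (of_real (- real n) - \<i> * of_real u))"
    proof -
      obtain n0 where "- b \<le> real n0" using real_arch_simple by blast
      then show ?thesis
        by (intro eventually_sequentiallyI[of n0] integral_gauss_Icc_iexp) auto
    qed
    ultimately show ?thesis
      by (rule Lim_transform_eventually)
  qed
  \<comment> \<open>This is the case b = u = 0 of the limit, where the integral is the mass 1/2 of a
    half-line.\<close>
  have "(\<lambda>n. 1/2 - gauss_Phi (of_real (- real n))) \<longlonglongrightarrow> 1/2"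
  proof -
    have m: "measure gauss {..0} = 1/2"
      using integral_gauss_atMost_0 by simp
    show ?thesis
      using lim[of 0 0] by (simp add: gauss_Phi_0 m)
  qed
  then have tail0: "(\<lambda>n. gauss_Phi (of_real (- real n))) \<longlonglongrightarrow> 0"
    by (drule_tac tendsto_diff[OF tendsto_const[of "1/2"]]) simp
  have tail: "(\<lambda>n. gauss_Phi (of_real (- real n) - \<i> * of_real u)) \<longlonglongrightarrow> 0" for u
  proof (rule Lim_transform[OF tail0])
    \<comment> \<open>On the segment from -n to -n-iu the modulus of exp(-z^2/2) is exp((Im(z)^2 -
      n^2)/2), hence at most exp((u^2 - n^2)/2); \<open>B n\<close> thus bounds the derivative of
      \<Phi> there.\<close>
    define B where "B n = exp ((u\<^sup>2 - (real n)\<^sup>2) / 2) / sqrt (2 * pi)" for n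
    have "norm (gauss_Phi (of_real (- real n) - \<i> * of_real u) - gauss_Phi (of_real (- real n))) \<le> B n * \<bar>u\<bar>" for n
    proof -
      define p q where "p = complex_of_real (- real n)" and "q = complex_of_real (- real n) - \<i> * of_real u"
      have "norm (gauss_Phi q - gauss_Phi p) \<le> B n * norm (q - p)"
      proof (rule field_differentiable_bound[where S = "closed_segment p q"])
        fix z assume "z \<in> closed_segment p q"
        then obtain t where t: "0 \<le> t" "t \<le> 1" and z: "z = (1 - t) *\<^sub>R p + t *\<^sub>R q"
          by (auto simp: closed_segment_def)
        have "Re z = - real n" "Im z = - t * u"
          unfolding z p_def q_def by (auto simp: algebra_simps)
        then have "Re (- z\<^sup>2 / 2) = ((t * u)\<^sup>2 - (real n)\<^sup>2) / 2"
          by (simp add: Re_power2 field_simps)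
        moreover have "(t * u)\<^sup>2 \<le> u\<^sup>2"
          using t by (simp add: power_mult_distrib mult_left_le_one_le power_le_one)
        ultimately show "norm (exp (- z\<^sup>2 / 2) / complex_of_real (sqrt (2 * pi))) \<le> B n"
          by (simp add: B_def norm_divide divide_right_mono del: of_real_mult)
        show "(gauss_Phi has_field_derivative exp (- z\<^sup>2 / 2) / complex_of_real (sqrt (2 * pi))) (at z within closed_segment p q)"
          by (rule has_field_derivative_at_within[OF gauss_Phi_has_field_derivative])
      qed auto
      then show ?thesis
        by (simp add: p_def q_def norm_mult)
    qed
    moreover have "(\<lambda>n. B n * \<bar>u\<bar>) \<longlonglongrightarrow> 0"
      unfolding B_def by real_asymp
    ultimately show "(\<lambda>n. gauss_Phi (of_real (- real n) - \<i> * of_real u) - gauss_Phi (of_real (- real n))) \<longlonglongrightarrow> 0"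
      by (rule Lim_null_comparison[OF always_eventually[OF allI]])
  qed
  have "(\<lambda>n. of_real (exp (- u\<^sup>2 / 2)) * (gauss_Phi (of_real b - \<i> * of_real u) - gauss_Phi (of_real (- real n) - \<i> * of_real u)))
     \<longlonglongrightarrow> of_real (exp (- u\<^sup>2 / 2)) * (gauss_Phi (of_real b - \<i> * of_real u) - 0)"
    by (intro tendsto_intros tail)
  from LIMSEQ_unique[OF lim this] show "(LINT y|gauss. indicat_real {..b} y * iexp (u * y))
     = of_real (exp (- u\<^sup>2 / 2)) * gauss_Phi (of_real b - \<i> * of_real u)"
    by simp
qed

lemma gauss_Phi_of_real: "gauss_Phi (of_real b) = of_real (measure gauss {..b})"
  using integral_gauss_atMost_iexp[of b 0] by simp

subsection \<open>Models of the Gaussian vector and the integral formula\<close>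

lemma centered_gaussian_eqI:
  assumes "finite I" "is_centered_gaussian I C M"
  shows "centered_gaussian I C = M"
  unfolding centered_gaussian_def
proof (rule the_equality)
  fix N assume "is_centered_gaussian I C N"
  then show "N = M"
    using assms unfolding is_centered_gaussian_def
    by (intro measure_eqI_PiM_iexp[of I]) (auto intro: prob_space.finite_measure)
qed fact

text \<open>The probability is written as the integral of a product of one-variable functions, the
  form in which both models can be integrated. For \<open>l = 0\<close> the empty product integrates
  to 1, in agreement with the convention for \<open>g_fun\<close>.\<close>

lemma g_fun_eq_integral:
  assumes "is_centered_gaussian {1..l} (\<lambda>i j. 1 / lam0 + (if i = j then 1 / lam i else 0)) M"
  shows "of_real (g_fun l lam0 lam (\<lambda>_. 1))
    = (LINT x|M. (\<Prod>j\<in>{1..l}. complex_of_real (indicator {..0} (x j))))"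
proof -
  interpret prob_space M using assms by (simp add: is_centered_gaussian_def)
  have sets_M[measurable_cong]: "sets M = sets (\<Pi>\<^sub>M i\<in>{1..l}. (borel :: real measure))"
    using assms by (simp add: is_centered_gaussian_def)
  define E where "E = {x \<in> space M. \<forall>j\<in>{1..l}. x j \<le> 0}"
  have [measurable]: "E \<in> sets M"
    unfolding E_def by measurable
  have "(\<Prod>j\<in>{1..l}. complex_of_real (indicator {..0} (x j))) = of_real (indicator E x)" if "x \<in> space M" for x
    using that by (auto simp: E_def indicator_def simp flip: of_real_prod intro!: prod.neutral)
  then have "(LINT x|M. (\<Prod>j\<in>{1..l}. complex_of_real (indicator {..0} (x j)))) = (LINT x|M. of_real (indicat_real E x))"
    by (intro Bochner_Integration.integral_cong) auto
  also have "\<dots> = of_real (prob E)"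
    using sets.sets_into_space[of E M] by (simp add: Int_absorb2)
  also have "prob E = g_fun l lam0 lam (\<lambda>_. 1)"
    using centered_gaussian_eqI[OF _ assms] prob_space by (auto simp: g_fun_def E_def Let_def)
  finally show ?thesis by simp
qed

lemma quadratic_form_covariance:
  fixes t lam :: "'i \<Rightarrow> real"
  assumes "finite I"
  shows "(\<Sum>i\<in>I. \<Sum>j\<in>I. t i * t j * (c + (if i = j then 1 / lam i else 0)))
    = c * (\<Sum>i\<in>I. t i)\<^sup>2 + (\<Sum>i\<in>I. (t i)\<^sup>2 / lam i)"
proof -
  have "(\<Sum>i\<in>I. \<Sum>j\<in>I. t i * t j * (c + (if i = j then 1 / lam i else 0)))
    = (\<Sum>i\<in>I. \<Sum>j\<in>I. c * (t i * t j) + (if i = j then (t i)\<^sup>2 / lam i else 0))"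
    by (intro sum.cong) (auto simp: algebra_simps power2_eq_square)
  then show ?thesis
    using assms by (simp add: sum.distrib power2_eq_square sum_product flip: sum_distrib_left)
qed

lemma sets_PiM_gauss: "sets (\<Pi>\<^sub>M i\<in>I. gauss) = sets (\<Pi>\<^sub>M i\<in>I. (borel :: real measure))"
  by (intro sets_PiM_cong) auto

text \<open>For fixed \<open>z\<close> the coordinates are independent, so the integral over them
  factorises; the bound 1 gives the integrability that Fubini's theorem needs. The first form serves
  the negative case, where \<open>z\<close> is introduced inside the integral over \<open>y\<close>;
  the second serves the positive case, where \<open>z\<close> is part of the sample.\<close>

lemma integral_gauss_mixture:
  fixes k :: "'i \<Rightarrow> real \<Rightarrow> real \<Rightarrow> complex"
  assumes I: "finite I"
    and meas: "\<And>j. j \<in> I \<Longrightarrow> (\<lambda>(z, y). k j z y) \<in> borel_measurable (borel \<Otimes>\<^sub>M borel)"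
    and bound: "\<And>j z y. norm (k j z y) \<le> 1"
  shows "(LINT y|(\<Pi>\<^sub>M i\<in>I. gauss). LINT z|gauss. (\<Prod>j\<in>I. k j z (y j)))
       = (LINT z|gauss. (\<Prod>j\<in>I. LINT y|gauss. k j z y))" (is ?swap)
    and "(LINT p|(gauss \<Otimes>\<^sub>M (\<Pi>\<^sub>M i\<in>I. gauss)). (\<Prod>j\<in>I. k j (fst p) (snd p j)))
       = (LINT z|gauss. (\<Prod>j\<in>I. LINT y|gauss. k j z y))" (is ?pair)
proof -
  interpret G: prob_space gauss by (rule prob_space_gauss)
  interpret P: prob_space "\<Pi>\<^sub>M i\<in>I. gauss" by (intro prob_space_PiM prob_space_gauss)
  interpret GP: pair_prob_space gauss "\<Pi>\<^sub>M i\<in>I. gauss" ..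
  interpret PS: product_sigma_finite "\<lambda>_::'i. gauss" by standard
  note [measurable_cong] = sets_PiM_gauss[of I]
  have m: "(\<lambda>p. k j (fst p) (snd p j)) \<in> borel_measurable (gauss \<Otimes>\<^sub>M (\<Pi>\<^sub>M i\<in>I. gauss))" if "j \<in> I" for j
  proof -
    have [measurable]: "(\<lambda>x. x j) \<in> borel_measurable (\<Pi>\<^sub>M i\<in>I. gauss)"
      using that by measurable
    have "(\<lambda>p. (fst p, snd p j)) \<in> gauss \<Otimes>\<^sub>M (\<Pi>\<^sub>M i\<in>I. gauss) \<rightarrow>\<^sub>M borel \<Otimes>\<^sub>M borel"
      by measurable
    from measurable_compose[OF this meas[OF that]] show ?thesis
      by simp
  qed
  have int: "integrable (gauss \<Otimes>\<^sub>M (\<Pi>\<^sub>M i\<in>I. gauss)) (\<lambda>(z, y). \<Prod>j\<in>I. k j z (y j))"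
    using m bound by (intro GP.integrable_const_bound[where B = 1])
      (auto simp: split_beta' prod_norm[symmetric] intro!: prod_le_1 AE_I2 borel_measurable_prod)
  have inner: "(LINT y|(\<Pi>\<^sub>M i\<in>I. gauss). (\<Prod>j\<in>I. k j z (y j))) = (\<Prod>j\<in>I. LINT y|gauss. k j z y)" for z
  proof (rule PS.product_integral_prod[OF I])
    fix j assume "j \<in> I"
    have "(\<lambda>y. (z, y)) \<in> borel \<rightarrow>\<^sub>M borel \<Otimes>\<^sub>M (borel :: real measure)"
      by simp
    from measurable_compose[OF this meas[OF \<open>j \<in> I\<close>]] show "integrable gauss (k j z)"
      using bound by (intro G.integrable_const_bound[where B = 1]) auto
  qed
  show ?swap
    using GP.Fubini_integral[OF int] by (simp add: inner)
  show ?pair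
    using GP.integral_fst'[OF int[unfolded split_beta']] by (simp add: inner split_beta')
qed

lemma char_gauss: "(LINT y|gauss. iexp (t * y)) = of_real (exp (- t\<^sup>2 / 2))"
  using char_std_normal_distribution by (simp add: char_def fun_eq_iff)

lemma norm_prod_le_1:
  fixes f :: "'i \<Rightarrow> complex"
  assumes "\<And>i. i \<in> I \<Longrightarrow> norm (f i) \<le> 1"
  shows "norm (\<Prod>i\<in>I. f i) \<le> 1"
  using assms by (auto simp: prod_norm[symmetric] intro!: prod_le_1)

text \<open>The minus sign makes the conditional probability of \<open>\<eta> j \<le> 0\<close> given \<open>z\<close> equal to
  \<open>\<Phi> (sqrt (lam j / lam0) * z)\<close> without a reflection of \<open>z\<close>.\<close>

definition positive_model :: "nat set \<Rightarrow> real \<Rightarrow> (nat \<Rightarrow> real) \<Rightarrow> (nat \<Rightarrow> real) measure" where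
  "positive_model I lam0 lam = distr (gauss \<Otimes>\<^sub>M (\<Pi>\<^sub>M i\<in>I. gauss)) (\<Pi>\<^sub>M i\<in>I. borel)
     (\<lambda>p. \<lambda>j\<in>I. snd p j / sqrt (lam j) - fst p / sqrt lam0)"

lemma integral_positive_model:
  fixes h :: "nat \<Rightarrow> real \<Rightarrow> complex"
  assumes I: "finite I" and h: "\<And>j. h j \<in> borel_measurable borel" "\<And>j x. norm (h j x) \<le> 1"
  shows "(LINT x|(positive_model I lam0 lam). (\<Prod>j\<in>I. h j (x j)))
    = (LINT z|gauss. (\<Prod>j\<in>I. LINT y|gauss. h j (y / sqrt (lam j) - z / sqrt lam0)))"
proof -
  note [measurable_cong] = sets_PiM_gauss[of I] and [measurable] = h(1)
  have "(LINT x|(positive_model I lam0 lam). (\<Prod>j\<in>I. h j (x j)))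
     = (LINT p|(gauss \<Otimes>\<^sub>M (\<Pi>\<^sub>M i\<in>I. gauss)). (\<Prod>j\<in>I. h j (snd p j / sqrt (lam j) - fst p / sqrt lam0)))"
    unfolding positive_model_def by (subst integral_distr) (auto cong: prod.cong)
  also have "\<dots> = (LINT z|gauss. (\<Prod>j\<in>I. LINT y|gauss. h j (y / sqrt (lam j) - z / sqrt lam0)))"
    using h by (intro integral_gauss_mixture(2)[OF I, where k = "\<lambda>j z y. h j (y / sqrt (lam j) - z / sqrt lam0)"]) auto
  finally show ?thesis .
qed

text \<open>Integrating out the coordinates leaves the diagonal part of the quadratic form and the
  phase of frequency \<open>- T / sqrt lam0\<close> in the common variable; its Gaussian integral
  supplies the rank-one part \<open>T\<^sup>2 / lam0\<close>.\<close>

lemma positive_model_gaussian: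
  assumes I: "finite I" and pos: "lam0 > 0" "\<And>j. j \<in> I \<Longrightarrow> lam j > 0"
  shows "is_centered_gaussian I (\<lambda>i j. 1 / lam0 + (if i = j then 1 / lam i else 0)) (positive_model I lam0 lam)"
  unfolding is_centered_gaussian_def
proof (intro conjI allI)
  interpret G: prob_space gauss by (rule prob_space_gauss)
  interpret P: prob_space "\<Pi>\<^sub>M i\<in>I. gauss" by (intro prob_space_PiM prob_space_gauss)
  interpret GP: pair_prob_space gauss "\<Pi>\<^sub>M i\<in>I. gauss" ..
  note [measurable_cong] = sets_PiM_gauss[of I]
  show "prob_space (positive_model I lam0 lam)"
    unfolding positive_model_def by (rule GP.prob_space_distr) measurable
  show "sets (positive_model I lam0 lam) = sets (\<Pi>\<^sub>M i\<in>I. borel)"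
    by (simp add: positive_model_def)
  fix t :: "nat \<Rightarrow> real"
  define T where "T = (\<Sum>i\<in>I. t i)"
  have inner: "(LINT y|gauss. iexp (t j * (y / sqrt (lam j) - z / sqrt lam0)))
      = of_real (exp (- ((t j)\<^sup>2 / lam j) / 2)) * iexp (- (t j) * z / sqrt lam0)" if "j \<in> I" for j z
  proof -
    have "iexp (t j * (y / sqrt (lam j) - z / sqrt lam0))
       = iexp (- (t j) * z / sqrt lam0) * iexp ((t j / sqrt (lam j)) * y)" for y
      by (simp add: algebra_simps flip: exp_add)
    then have "(LINT y|gauss. iexp (t j * (y / sqrt (lam j) - z / sqrt lam0)))
       = iexp (- (t j) * z / sqrt lam0) * of_real (exp (- (t j / sqrt (lam j))\<^sup>2 / 2))"
      by (simp only: integral_mult_right_zero char_gauss)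
    then show ?thesis
      using pos(2)[OF that] by (simp add: power_divide mult.commute)
  qed
  have "(LINT x|(positive_model I lam0 lam). iexp (\<Sum>i\<in>I. t i * x i))
    = (LINT x|(positive_model I lam0 lam). (\<Prod>j\<in>I. iexp (t j * x j)))"
    using I by (simp add: exp_sum sum_distrib_left)
  also have "\<dots> = (LINT z|gauss. (\<Prod>j\<in>I. LINT y|gauss. iexp (t j * (y / sqrt (lam j) - z / sqrt lam0))))"
    by (rule integral_positive_model[OF I, where h = "\<lambda>j x. iexp (t j * x)"]) auto
  also have "\<dots> = (LINT z|gauss. of_real (exp (- (\<Sum>j\<in>I. (t j)\<^sup>2 / lam j) / 2)) * iexp ((- T / sqrt lam0) * z))"
  proof (rule Bochner_Integration.integral_cong[OF refl])
    fix z
    have "(\<Prod>j\<in>I. LINT y|gauss. iexp (t j * (y / sqrt (lam j) - z / sqrt lam0)))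
      = (\<Prod>j\<in>I. of_real (exp (- ((t j)\<^sup>2 / lam j) / 2)) * iexp (- (t j) * z / sqrt lam0))"
      by (intro prod.cong inner refl)
    also have "\<dots> = of_real (\<Prod>j\<in>I. exp (- ((t j)\<^sup>2 / lam j) / 2)) * (\<Prod>j\<in>I. iexp (- (t j) * z / sqrt lam0))"
      by (simp only: prod.distrib of_real_prod)
    also have "(\<Prod>j\<in>I. exp (- ((t j)\<^sup>2 / lam j) / 2)) = exp (- (\<Sum>j\<in>I. (t j)\<^sup>2 / lam j) / 2)"
      using I by (simp add: sum_negf sum_divide_distrib flip: exp_sum)
    also have "(\<Prod>j\<in>I. iexp (- (t j) * z / sqrt lam0)) = exp (\<Sum>j\<in>I. \<i> * complex_of_real (- (t j) * z / sqrt lam0))"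
      using I by (simp add: exp_sum)
    also have "(\<Sum>j\<in>I. \<i> * complex_of_real (- (t j) * z / sqrt lam0)) = \<i> * complex_of_real ((- T / sqrt lam0) * z)"
      by (simp only: of_real_sum[symmetric] sum_distrib_left[symmetric]) (simp add: T_def sum_negf sum_divide_distrib sum_distrib_right)
    finally show "(\<Prod>j\<in>I. LINT y|gauss. iexp (t j * (y / sqrt (lam j) - z / sqrt lam0)))
      = of_real (exp (- (\<Sum>j\<in>I. (t j)\<^sup>2 / lam j) / 2)) * iexp ((- T / sqrt lam0) * z)" .
  qed
  also have "\<dots> = of_real (exp (- (\<Sum>j\<in>I. (t j)\<^sup>2 / lam j) / 2)) * of_real (exp (- (- T / sqrt lam0)\<^sup>2 / 2))"
    by (simp only: integral_mult_right_zero char_gauss)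
  also have "\<dots> = of_real (exp (- (\<Sum>i\<in>I. \<Sum>j\<in>I. t i * t j * (1 / lam0 + (if i = j then 1 / lam i else 0))) / 2))"
    unfolding quadratic_form_covariance[OF I] using pos(1)
    by (simp add: T_def power_divide add_divide_distrib diff_divide_distrib flip: exp_add of_real_mult)
  finally show "(LINT x|(positive_model I lam0 lam). iexp (\<Sum>i\<in>I. t i * x i))
    = of_real (exp (- (\<Sum>i\<in>I. \<Sum>j\<in>I. t i * t j * (1 / lam0 + (if i = j then 1 / lam i else 0))) / 2))" .
qed

lemma g_fun_integral_positive:
  fixes l lam0 lam
  defines "f \<equiv> \<lambda>x::real. (\<Prod>j=1..l. gauss_Phi (sqrt_ratio (lam j) lam0 * of_real x)) * of_real (exp (- x\<^sup>2 / 2))"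
  assumes pos: "lam0 > 0" "\<And>j. j \<in> {1..l} \<Longrightarrow> lam j > 0"
  shows "integrable lborel f"
    and "of_real (g_fun l lam0 lam (\<lambda>_. 1)) = 1 / of_real (sqrt (2 * pi)) * (LINT x|lborel. f x)"
proof -
  interpret G: prob_space gauss by (rule prob_space_gauss)
  let ?F = "\<lambda>x. \<Prod>j=1..l. gauss_Phi (sqrt_ratio (lam j) lam0 * of_real x)"
  have F_meas[measurable]: "?F \<in> borel_measurable borel"
    by (intro borel_measurable_continuous_onI continuous_intros continuous_on_compose2[OF continuous_on_gauss_Phi]) auto
  \<comment> \<open>For \<open>lam0 > 0\<close> the arguments are real, so every factor is a
    probability and the product is bounded by 1.\<close>
  have Phi: "gauss_Phi (sqrt_ratio (lam j) lam0 * of_real x) = of_real (measure gauss {..sqrt (lam j / lam0) * x})" for j x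
    using pos(1) by (simp add: sqrt_ratio_def gauss_Phi_of_real flip: of_real_mult)
  have F1: "norm (?F x) \<le> 1" for x
    by (intro norm_prod_le_1) (simp add: Phi)
  have f: "f x = of_real (sqrt (2 * pi)) * (std_normal_density x *\<^sub>R ?F x)" for x
    by (simp add: f_def std_normal_density_def scaleR_conv_of_real)
  have "integrable gauss ?F"
    using F1 by (intro G.integrable_const_bound[where B = 1]) (auto simp del: One_nat_def)
  then have "integrable lborel (\<lambda>x. std_normal_density x *\<^sub>R ?F x)"
    by (subst (asm) integrable_density) (auto simp del: One_nat_def)
  then show "integrable lborel f"
    unfolding f by (rule integrable_mult_right)
  have "complex_of_real (g_fun l lam0 lam (\<lambda>_. 1)) =
     (LINT x|(positive_model {1..l} lam0 lam). (\<Prod>j\<in>{1..l}. complex_of_real (indicator {..0} (x j))))"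
    using pos by (intro g_fun_eq_integral positive_model_gaussian) auto
  also have "\<dots> = (LINT z|gauss. (\<Prod>j=1..l. LINT y|gauss. complex_of_real (indicator {..0} (y / sqrt (lam j) - z / sqrt lam0))))"
    by (rule integral_positive_model[where h = "\<lambda>j x. complex_of_real (indicator {..0} x)"]) (auto simp: indicator_def)
  also have "\<dots> = (LINT z|gauss. ?F z)"
  proof (intro Bochner_Integration.integral_cong prod.cong refl)
    fix z j assume j: "j \<in> {1..l}"
    have "indicat_real {..0} (y / sqrt (lam j) - z / sqrt lam0) = indicat_real {..sqrt (lam j / lam0) * z} y" for y
      using pos(1) pos(2)[OF j] by (auto simp: indicator_def real_sqrt_divide field_simps)
    then show "(LINT y|gauss. complex_of_real (indicator {..0} (y / sqrt (lam j) - z / sqrt lam0)))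
       = gauss_Phi (sqrt_ratio (lam j) lam0 * of_real z)"
      by (simp add: Phi)
  qed
  also have "\<dots> = 1 / of_real (sqrt (2 * pi)) * (LINT x|lborel. f x)"
    unfolding f by (subst integral_gauss[OF F_meas]) (simp only: integral_mult_right_zero, simp)
  finally show "complex_of_real (g_fun l lam0 lam (\<lambda>_. 1)) = 1 / of_real (sqrt (2 * pi)) * (LINT x|lborel. f x)" .
qed

text \<open>Here \<open>s\<close> stands for \<open>- (lam0 + (\<Sum>j\<in>I. lam j))\<close>; the normalising constant is
  \<open>sqrt (1 + (\<Sum>j\<in>I. lam j) / s) = sqrt (- lam0 / s)\<close>.\<close>

definition negative_model :: "nat set \<Rightarrow> real \<Rightarrow> (nat \<Rightarrow> real) \<Rightarrow> (nat \<Rightarrow> real) measure" where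
  "negative_model I s lam = distr
     (density (\<Pi>\<^sub>M i\<in>I. gauss)
       (\<lambda>y. ennreal (sqrt (1 + (\<Sum>j\<in>I. lam j) / s) * exp (- ((\<Sum>j\<in>I. sqrt (lam j) * y j) / sqrt s)\<^sup>2 / 2))))
     (\<Pi>\<^sub>M i\<in>I. borel) (\<lambda>y. \<lambda>j\<in>I. y j / sqrt (lam j))"

lemma integral_negative_model:
  fixes h :: "nat \<Rightarrow> real \<Rightarrow> complex"
  assumes I: "finite I" and h: "\<And>j. h j \<in> borel_measurable borel" "\<And>j x. norm (h j x) \<le> 1"
    and nn: "s > 0" "\<And>j. j \<in> I \<Longrightarrow> lam j > 0"
  shows "(LINT x|(negative_model I s lam). (\<Prod>j\<in>I. h j (x j)))
    = of_real (sqrt (1 + (\<Sum>j\<in>I. lam j) / s)) *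
      (LINT z|gauss. (\<Prod>j\<in>I. LINT y|gauss. h j (y / sqrt (lam j)) * iexp (sqrt (lam j) * z / sqrt s * y)))"
proof -
  note [measurable_cong] = sets_PiM_gauss[of I] and [measurable] = h(1)
  define K where "K = sqrt (1 + (\<Sum>j\<in>I. lam j) / s)"
  define q where "q y = (\<Sum>j\<in>I. sqrt (lam j) * y j) / sqrt s" for y
  define k where "k j z y = h j (y / sqrt (lam j)) * iexp (sqrt (lam j) * z / sqrt s * y)" for j z y
  have K: "K \<ge> 0" using nn by (simp add: K_def sum_nonneg less_imp_le)
  have [measurable]: "q \<in> borel_measurable (\<Pi>\<^sub>M i\<in>I. borel)"
    unfolding q_def by measurable
  have "(LINT x|(negative_model I s lam). (\<Prod>j\<in>I. h j (x j)))
     = (LINT y|(\<Pi>\<^sub>M i\<in>I. gauss). (K * exp (- (q y)\<^sup>2 / 2)) *\<^sub>R (\<Prod>j\<in>I. h j (y j / sqrt (lam j))))"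
    unfolding negative_model_def K_def[symmetric] q_def[symmetric] using K
    by (subst integral_distr) (auto simp: integral_density cong: prod.cong)
  also have "\<dots> = (LINT y|(\<Pi>\<^sub>M i\<in>I. gauss). of_real K * (LINT z|gauss. (\<Prod>j\<in>I. k j z (y j))))"
  proof (rule Bochner_Integration.integral_cong[OF refl])
    fix y
    \<comment> \<open>Since \<open>q\<close> is linear in \<open>y\<close>, the phase
      \<open>iexp (q y * z)\<close> splits into one factor per coordinate, whereas the square in the
      density couples them all.\<close>
    have "(\<Prod>j\<in>I. k j z (y j)) = (\<Prod>j\<in>I. h j (y j / sqrt (lam j))) * iexp (q y * z)" for z
    proof -
      have "(\<Prod>j\<in>I. iexp (sqrt (lam j) * z / sqrt s * y j)) = exp (\<Sum>j\<in>I. \<i> * complex_of_real (sqrt (lam j) * z / sqrt s * y j))"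
        using I by (simp add: exp_sum)
      also have "(\<Sum>j\<in>I. \<i> * complex_of_real (sqrt (lam j) * z / sqrt s * y j)) = \<i> * complex_of_real (q y * z)"
        by (simp only: of_real_sum[symmetric] sum_distrib_left[symmetric])
          (simp add: q_def sum_divide_distrib sum_distrib_left mult_ac)
      finally show ?thesis
        unfolding k_def prod.distrib by simp
    qed
    then show "(K * exp (- (q y)\<^sup>2 / 2)) *\<^sub>R (\<Prod>j\<in>I. h j (y j / sqrt (lam j))) = of_real K * (LINT z|gauss. (\<Prod>j\<in>I. k j z (y j)))"
      by (simp only: integral_mult_right_zero char_gauss) (simp add: scaleR_conv_of_real)
  qed
  also have "\<dots> = of_real K * (LINT y|(\<Pi>\<^sub>M i\<in>I. gauss). LINT z|gauss. (\<Prod>j\<in>I. k j z (y j)))"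
    by (simp only: integral_mult_right_zero)
  also have "(LINT y|(\<Pi>\<^sub>M i\<in>I. gauss). LINT z|gauss. (\<Prod>j\<in>I. k j z (y j))) = (LINT z|gauss. (\<Prod>j\<in>I. LINT y|gauss. k j z y))"
    using h unfolding k_def by (intro integral_gauss_mixture(1)[OF I]) (auto simp: norm_mult)
  finally show ?thesis
    by (simp add: K_def k_def)
qed

text \<open>Each one-dimensional factor is a characteristic function at a real frequency depending
  on \<open>z\<close>, so their product is the exponential of a real quadratic polynomial in
  \<open>z\<close>. Its Gaussian integral cancels the normalising constant and leaves
  \<open>exp (T\<^sup>2 / (2 * (s + L)))\<close>, which is the rank-one term because
  \<open>s + L = - lam0\<close>.\<close>

lemma negative_model_gaussian:
  assumes I: "finite I" and pos: "\<And>j. j \<in> I \<Longrightarrow> lam j > 0" and neg: "lam0 < - (\<Sum>j\<in>I. lam j)"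
  defines "s \<equiv> - (lam0 + (\<Sum>j\<in>I. lam j))"
  shows "is_centered_gaussian I (\<lambda>i j. 1 / lam0 + (if i = j then 1 / lam i else 0)) (negative_model I s lam)"
proof -
  note [measurable_cong] = sets_PiM_gauss[of I]
  define L where "L = (\<Sum>j\<in>I. lam j)"
  have s: "s > 0" using neg by (simp add: s_def)
  have L: "L \<ge> 0" using pos by (auto simp: L_def less_imp_le intro!: sum_nonneg)
  have sL: "s + L = - lam0" by (simp add: s_def L_def)
  have char: "(LINT x|(negative_model I s lam). iexp (\<Sum>i\<in>I. t i * x i)) =
     of_real (exp (- (\<Sum>i\<in>I. \<Sum>j\<in>I. t i * t j * (1 / lam0 + (if i = j then 1 / lam i else 0))) / 2))"
    for t :: "nat \<Rightarrow> real"
  proof -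
    define T A where "T = (\<Sum>i\<in>I. t i)" and "A = (\<Sum>i\<in>I. (t i)\<^sup>2 / lam i)"
    have inner: "(LINT y|gauss. iexp (t j * (y / sqrt (lam j))) * iexp (sqrt (lam j) * z / sqrt s * y))
        = of_real (exp (- ((t j)\<^sup>2 / lam j + 2 * z / sqrt s * t j + z\<^sup>2 / s * lam j) / 2))" if "j \<in> I" for j z
    proof -
      have "iexp (t j * (y / sqrt (lam j))) * iexp (sqrt (lam j) * z / sqrt s * y)
         = iexp ((t j / sqrt (lam j) + sqrt (lam j) * z / sqrt s) * y)" for y
        by (simp add: algebra_simps flip: exp_add)
      \<comment> \<open>In the cross term \<open>lam j\<close> cancels, so summation over
        \<open>j\<close> produces the plain sum \<open>T\<close>.\<close>
      moreover have "(t j / sqrt (lam j) + sqrt (lam j) * z / sqrt s)\<^sup>2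
          = (t j)\<^sup>2 / lam j + 2 * z / sqrt s * t j + z\<^sup>2 / s * lam j"
        using pos[OF that] s by (simp add: power2_sum power_divide power_mult_distrib mult_ac)
      ultimately show ?thesis
        by (simp only: char_gauss)
    qed
    have "(LINT x|(negative_model I s lam). iexp (\<Sum>i\<in>I. t i * x i))
      = (LINT x|(negative_model I s lam). (\<Prod>j\<in>I. iexp (t j * x j)))"
      using I by (simp add: exp_sum sum_distrib_left)
    also have "\<dots> = of_real (sqrt (1 + L / s)) * (LINT z|gauss. (\<Prod>j\<in>I. LINT y|gauss.
        iexp (t j * (y / sqrt (lam j))) * iexp (sqrt (lam j) * z / sqrt s * y)))"
      unfolding L_def using s pos by (intro integral_negative_model[OF I, where h = "\<lambda>j x. iexp (t j * x)"]) auto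
    also have "(LINT z|gauss. (\<Prod>j\<in>I. LINT y|gauss.
        iexp (t j * (y / sqrt (lam j))) * iexp (sqrt (lam j) * z / sqrt s * y)))
      = (LINT z|gauss. complex_of_real (exp (- A / 2) * exp (- (L / s * z\<^sup>2 / 2 + T / sqrt s * z))))"
    proof (rule Bochner_Integration.integral_cong[OF refl])
      fix z
      have "(\<Prod>j\<in>I. LINT y|gauss. iexp (t j * (y / sqrt (lam j))) * iexp (sqrt (lam j) * z / sqrt s * y))
        = of_real (\<Prod>j\<in>I. exp (- ((t j)\<^sup>2 / lam j + 2 * z / sqrt s * t j + z\<^sup>2 / s * lam j) / 2))"
        unfolding of_real_prod by (intro prod.cong inner refl)
      also have "(\<Prod>j\<in>I. exp (- ((t j)\<^sup>2 / lam j + 2 * z / sqrt s * t j + z\<^sup>2 / s * lam j) / 2))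
        = exp (- (A + 2 * z / sqrt s * T + z\<^sup>2 / s * L) / 2)"
        using I unfolding A_def T_def L_def sum_distrib_left sum.distrib[symmetric]
        by (simp only: exp_sum[symmetric] sum_divide_distrib sum_negf[symmetric])
      also have "\<dots> = exp (- A / 2) * exp (- (L / s * z\<^sup>2 / 2 + T / sqrt s * z))"
        unfolding exp_add[symmetric] by (simp add: field_simps)
      finally show "(\<Prod>j\<in>I. LINT y|gauss. iexp (t j * (y / sqrt (lam j))) * iexp (sqrt (lam j) * z / sqrt s * y))
        = complex_of_real (exp (- A / 2) * exp (- (L / s * z\<^sup>2 / 2 + T / sqrt s * z)))" .
    qed
    also have "\<dots> = of_real (exp (- A / 2) * (exp ((T / sqrt s)\<^sup>2 / (2 * (1 + L / s))) / sqrt (1 + L / s)))"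
      using s L by (simp only: integral_complex_of_real integral_mult_right_zero)
        (subst integral_gauss_exp_quadratic, auto intro!: add_pos_nonneg)
    also have "of_real (sqrt (1 + L / s)) * \<dots> = of_real (exp (- A / 2) * exp ((T / sqrt s)\<^sup>2 / (2 * (1 + L / s))))"
    proof -
      have "sqrt (1 + L / s) \<noteq> 0"
        using s L by (simp add: add_pos_nonneg less_imp_neq[symmetric])
      then show ?thesis by simp
    qed
    also have "exp (- A / 2) * exp ((T / sqrt s)\<^sup>2 / (2 * (1 + L / s))) = exp (- (1 / lam0 * T\<^sup>2 + A) / 2)"
    proof -
      have "(T / sqrt s)\<^sup>2 / (2 * (1 + L / s)) = T\<^sup>2 / (2 * (s + L))"
        using s by (simp add: power_divide field_simps)
      then show ?thesis
        unfolding sL exp_add[symmetric] by (simp add: add_divide_distrib)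
    qed
    finally show ?thesis
      unfolding quadratic_form_covariance[OF I] T_def A_def .
  qed
  show ?thesis
    unfolding is_centered_gaussian_def
  proof (intro conjI allI char)
    show "sets (negative_model I s lam) = sets (\<Pi>\<^sub>M i\<in>I. borel)"
      by (simp add: negative_model_def)
    \<comment> \<open>The characteristic function at 0 is the total mass, so the normalisation needs
      no separate integral. An infinite mass would make \<open>measure\<close> equal to 0, hence the
      value 1 carries over to \<open>emeasure\<close>.\<close>
    have "measure (negative_model I s lam) (space (negative_model I s lam)) = 1"
      using char[of "\<lambda>_. 0"] by (simp add: scaleR_conv_of_real)
    then have "emeasure (negative_model I s lam) (space (negative_model I s lam)) = 1"
      by (metis emeasure_eq_ennreal_measure ennreal_1 measure_zero_top zero_neq_one)
    then show "prob_space (negative_model I s lam)"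
      by (rule prob_spaceI)
  qed
qed

text \<open>On the imaginary axis \<Phi>(-iu) = exp(u^2/2) H(u) with |H| <= 1. The growth factors
  multiply to exp(x^2 L/(2m)), and against exp(-x^2/2) there remains exp(-(s/m) x^2/2), which is
  integrable as \<open>s > 0\<close>. The model gives the same integral of a product of
  \<open>H\<close> in another scale.\<close>

lemma g_fun_integral_negative:
  fixes l lam0 lam
  defines "f \<equiv> \<lambda>x::real. (\<Prod>j=1..l. gauss_Phi (sqrt_ratio (lam j) lam0 * of_real x)) * of_real (exp (- x\<^sup>2 / 2))"
  assumes pos: "\<And>j. j \<in> {1..l} \<Longrightarrow> lam j > 0" and neg: "lam0 < - (\<Sum>j=1..l. lam j)"
  shows "integrable lborel f"
    and "of_real (g_fun l lam0 lam (\<lambda>_. 1)) = 1 / of_real (sqrt (2 * pi)) * (LINT x|lborel. f x)"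
proof -
  interpret G: prob_space gauss by (rule prob_space_gauss)
  define L where "L = (\<Sum>j=1..l. lam j)"
  define m where "m = - lam0"
  define s where "s = m - L"
  have L: "L \<ge> 0" using pos by (auto simp: L_def less_imp_le intro!: sum_nonneg)
  have s: "s > 0" and m: "m > 0" and s_eq: "- (lam0 + (\<Sum>j=1..l. lam j)) = s"
    using neg L by (auto simp: s_def L_def m_def)
  let ?F = "\<lambda>x. \<Prod>j=1..l. gauss_Phi (sqrt_ratio (lam j) lam0 * of_real x)"
  have F_meas: "?F \<in> borel_measurable borel"
    by (intro borel_measurable_continuous_onI continuous_intros continuous_on_compose2[OF continuous_on_gauss_Phi]) auto
  have f_meas: "f \<in> borel_measurable borel"
    unfolding f_def by (intro borel_measurable_times F_meas) auto
  \<comment> \<open>The chosen branch has 1/i = -i, so the argument is purely imaginary and fits the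
    truncated characteristic function with upper limit 0.\<close>
  have ratio: "sqrt_ratio (lam j) lam0 * of_real x = of_real 0 - \<i> * of_real (sqrt (lam j) / sqrt m * x)" for j x
    using m by (simp add: sqrt_ratio_def m_def field_simps)
  define H where "H u = (LINT y|gauss. indicat_real {..0} y * iexp (u * y))" for u
  have H1: "norm (H u) \<le> 1" for u
  proof -
    have "norm (H u) \<le> (LINT y|gauss. norm (indicat_real {..0} y * iexp (u * y)))"
      unfolding H_def by (rule integral_norm_bound)
    also have "\<dots> \<le> (LINT y|gauss. 1)"
      by (intro integral_mono G.integrable_const_bound[where B = 1]) (auto simp: norm_mult indicator_def)
    finally show ?thesis using G.prob_space by simp
  qed
  have Phi: "gauss_Phi (of_real 0 - \<i> * of_real u) = of_real (exp (u\<^sup>2 / 2)) * H u" for u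
    unfolding H_def integral_gauss_atMost_iexp by (simp flip: exp_add of_real_mult)
  have prodH: "(\<Prod>j=1..l. of_real (exp (c * lam j)) * H (u j)) = of_real (exp (c * L)) * (\<Prod>j=1..l. H (u j))" for c u
  proof -
    have "(\<Prod>j=1..l. exp (c * lam j)) = exp (c * L)"
      unfolding L_def sum_distrib_left by (simp add: exp_sum)
    then show ?thesis
      unfolding prod.distrib of_real_prod[symmetric] by simp
  qed
  have F: "?F x = of_real (exp (x\<^sup>2 / (2 * m) * L)) * (\<Prod>j=1..l. H (sqrt (lam j) / sqrt m * x))" for x
  proof -
    have "?F x = (\<Prod>j=1..l. of_real (exp (x\<^sup>2 / (2 * m) * lam j)) * H (sqrt (lam j) / sqrt m * x))"
      unfolding ratio Phi using pos m
      by (intro prod.cong refl arg_cong2[of _ _ _ _ "(*)"] arg_cong[of _ _ of_real] arg_cong[of _ _ exp])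
        (auto simp: power_mult_distrib power_divide less_imp_le mult_ac)
    then show ?thesis
      unfolding prodH .
  qed
  have f: "f x = of_real (exp (- (s / m) * x\<^sup>2 / 2)) * (\<Prod>j=1..l. H (sqrt (lam j) / sqrt m * x))" for x
  proof -
    have "exp (x\<^sup>2 / (2 * m) * L) * exp (- x\<^sup>2 / 2) = exp (- (s / m) * x\<^sup>2 / 2)"
      unfolding exp_add[symmetric] s_def using m by (simp add: field_simps)
    then show ?thesis
      unfolding f_def F by (simp flip: of_real_mult)
  qed
  show "integrable lborel f"
  proof (rule Bochner_Integration.integrable_bound)
    show "integrable lborel (\<lambda>x. exp (- (s / m) * x\<^sup>2 / 2))"
      using s m by (intro integrable_exp_neg_half_square) auto
    show "AE x in lborel. norm (f x) \<le> norm (exp (- (s / m) * x\<^sup>2 / 2))"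
      unfolding f norm_mult using H1 by (intro AE_I2) (simp add: mult_left_le norm_prod_le_1)
  qed (use f_meas in simp)
  \<comment> \<open>The substitution \<open>z = r * x\<close> turns the scale
    \<open>1 / sqrt s\<close> of the model into the scale \<open>1 / sqrt m\<close> of the formula.
    Its Jacobian cancels the normalising constant, since \<open>1 + L / s = m / s\<close>.\<close>
  define r where "r = sqrt (s / m)"
  have r: "r > 0" using s m by (simp add: r_def)
  have "complex_of_real (g_fun l lam0 lam (\<lambda>_. 1)) =
     (LINT x|(negative_model {1..l} s lam). (\<Prod>j\<in>{1..l}. complex_of_real (indicator {..0} (x j))))"
    using negative_model_gaussian[of "{1..l}" lam lam0] pos neg unfolding s_eq by (intro g_fun_eq_integral) auto
  also have "\<dots> = of_real (sqrt (1 + L / s)) * (LINT z|gauss. (\<Prod>j=1..l. LINT y|gauss.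
      complex_of_real (indicator {..0} (y / sqrt (lam j))) * iexp (sqrt (lam j) * z / sqrt s * y)))"
    unfolding L_def using s pos
    by (intro integral_negative_model[where h = "\<lambda>j x. complex_of_real (indicator {..0} x)"]) (auto simp: indicator_def)
  also have "sqrt (1 + L / s) = 1 / r"
    using s m by (simp add: r_def real_sqrt_divide s_def field_simps)
  also have "(LINT z|gauss. (\<Prod>j=1..l. LINT y|gauss.
      complex_of_real (indicator {..0} (y / sqrt (lam j))) * iexp (sqrt (lam j) * z / sqrt s * y)))
    = (LINT z|gauss. (\<Prod>j=1..l. H (sqrt (lam j) / sqrt s * z)))"
  proof (intro Bochner_Integration.integral_cong prod.cong refl)
    fix z j assume j: "j \<in> {1..l}"
    have "indicat_real {..0} (y / sqrt (lam j)) = indicat_real {..0} y" for y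
      using pos[OF j] by (auto simp: indicator_def field_simps)
    then show "(LINT y|gauss. complex_of_real (indicator {..0} (y / sqrt (lam j))) * iexp (sqrt (lam j) * z / sqrt s * y))
       = H (sqrt (lam j) / sqrt s * z)"
      by (simp add: H_def)
  qed
  also have "\<dots> = (LINT z|lborel. std_normal_density z *\<^sub>R (\<Prod>j=1..l. H (sqrt (lam j) / sqrt s * z)))"
  proof (rule integral_gauss)
    \<comment> \<open>Measurability of \<open>H\<close>, defined as a parameter integral, is read
      off its closed form in terms of \<Phi>.\<close>
    have "continuous_on UNIV (\<lambda>u. gauss_Phi (of_real 0 - \<i> * of_real u))"
      by (rule continuous_on_compose2[OF continuous_on_gauss_Phi[of UNIV]]) (auto intro!: continuous_intros)
    then have "continuous_on UNIV (\<lambda>u. of_real (exp (- u\<^sup>2 / 2)) * gauss_Phi (of_real 0 - \<i> * of_real u))"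
      by (intro continuous_on_mult) (auto intro!: continuous_intros)
    then have "continuous_on UNIV H"
      unfolding H_def integral_gauss_atMost_iexp .
    then show "(\<lambda>z. \<Prod>j=1..l. H (sqrt (lam j) / sqrt s * z)) \<in> borel_measurable borel"
      using s
      by (intro borel_measurable_continuous_onI continuous_on_prod)
        (auto intro!: continuous_on_compose2[of UNIV H] continuous_intros)
  qed
  also have "\<dots> = r *\<^sub>R (LINT x|lborel. std_normal_density (r * x) *\<^sub>R (\<Prod>j=1..l. H (sqrt (lam j) / sqrt s * (r * x))))"
    using r by (subst lborel_integral_real_affine[where c = r and t = 0]) auto
  also have "(\<lambda>x. std_normal_density (r * x) *\<^sub>R (\<Prod>j=1..l. H (sqrt (lam j) / sqrt s * (r * x))))
    = (\<lambda>x. 1 / of_real (sqrt (2 * pi)) * f x)"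
  proof
    fix x
    have "sqrt (lam j) / sqrt s * (r * x) = sqrt (lam j) / sqrt m * x" for j
      using s by (simp add: r_def real_sqrt_divide)
    moreover have "(r * x)\<^sup>2 = s / m * x\<^sup>2"
      using s m by (simp add: r_def power_mult_distrib)
    ultimately show "std_normal_density (r * x) *\<^sub>R (\<Prod>j=1..l. H (sqrt (lam j) / sqrt s * (r * x))) = 1 / of_real (sqrt (2 * pi)) * f x"
      unfolding f std_normal_density_def by (simp add: scaleR_conv_of_real)
  qed
  also have "complex_of_real (1 / r) * (r *\<^sub>R (LINT x|lborel. 1 / of_real (sqrt (2 * pi)) * f x))
      = 1 / of_real (sqrt (2 * pi)) * (LINT x|lborel. f x)"
    using r by (simp only: integral_mult_right_zero) (simp add: scaleR_conv_of_real)
  finally show "complex_of_real (g_fun l lam0 lam (\<lambda>_. 1)) = 1 / of_real (sqrt (2 * pi)) * (LINT x|lborel. f x)" .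
qed

subsection \<open>Solid angles and faces of the simplex\<close>

text \<open>These four facts make the chosen basis irrelevant. The characteristic function is a
  product over the basis, and for \<open>w \<in> L\<close> Parseval's identity sums the exponents to
  \<open>w \<bullet> w\<close>.\<close>

lemma std_gaussian_on_subspace:
  fixes L :: "'a::euclidean_space set"
  assumes L: "subspace L"
  shows prob_space_std_gaussian_on: "prob_space (std_gaussian_on L)"
    and sets_std_gaussian_on: "sets (std_gaussian_on L) = sets borel"
    and AE_std_gaussian_on: "AE v in std_gaussian_on L. v \<in> L"
    and char_std_gaussian_on:
      "w \<in> L \<Longrightarrow> (LINT v|(std_gaussian_on L). iexp (w \<bullet> v)) = of_real (exp (- (w \<bullet> w) / 2))"
proof -
  define B where "B = (SOME B. orthonormal_basis_of L B)"
  have "\<exists>B. orthonormal_basis_of L B"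
    using orthonormal_basis_subspace[OF L] unfolding orthonormal_basis_of_def by metis
  then have "orthonormal_basis_of L B"
    unfolding B_def by (rule someI_ex)
  then have B: "pairwise orthogonal B" "\<And>b. b \<in> B \<Longrightarrow> norm b = 1" "span B = L"
    by (auto simp: orthonormal_basis_of_def)
  have "0 \<notin> B" using B(2)[of 0] by auto
  then have fin: "finite B"
    using pairwise_orthogonal_independent[OF B(1)] independent_imp_finite by blast
  interpret G: prob_space gauss by (rule prob_space_gauss)
  interpret P: prob_space "\<Pi>\<^sub>M b\<in>B. gauss" by (intro prob_space_PiM prob_space_gauss)
  interpret PS: product_sigma_finite "\<lambda>_::'a. gauss" by standard
  note [measurable_cong] = sets_PiM_gauss[of B]
  have eq: "std_gaussian_on L = distr (\<Pi>\<^sub>M b\<in>B. gauss) borel (\<lambda>x. \<Sum>b\<in>B. x b *\<^sub>R b)"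
    by (simp add: std_gaussian_on_def B_def Let_def)
  have [measurable]: "(\<lambda>x. \<Sum>b\<in>B. x b *\<^sub>R b) \<in> borel_measurable (\<Pi>\<^sub>M b\<in>B. gauss)"
    by measurable
  show "prob_space (std_gaussian_on L)"
    unfolding eq by (rule P.prob_space_distr) measurable
  show "sets (std_gaussian_on L) = sets borel"
    by (simp add: eq)
  have [measurable]: "L \<in> sets borel"
    using closed_subspace[OF L] by auto
  have "(\<Sum>b\<in>B. x b *\<^sub>R b) \<in> L" for x
    unfolding B(3)[symmetric] by (intro span_sum span_scale span_base)
  then show "AE v in std_gaussian_on L. v \<in> L"
    unfolding eq by (subst AE_distr_iff) auto
  assume w: "w \<in> L"
  have "(LINT v|(std_gaussian_on L). iexp (w \<bullet> v)) = (LINT x|(\<Pi>\<^sub>M b\<in>B. gauss). iexp (w \<bullet> (\<Sum>b\<in>B. x b *\<^sub>R b)))"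
    unfolding eq by (subst integral_distr) auto
  also have "\<dots> = (LINT x|(\<Pi>\<^sub>M b\<in>B. gauss). (\<Prod>b\<in>B. iexp ((w \<bullet> b) * x b)))"
    using fin by (simp add: inner_sum_right exp_sum sum_distrib_left mult.commute)
  also have "\<dots> = (\<Prod>b\<in>B. LINT y|gauss. iexp ((w \<bullet> b) * y))"
    by (intro PS.product_integral_prod fin G.integrable_iexp) auto
  also have "\<dots> = of_real (exp (\<Sum>b\<in>B. - (w \<bullet> b)\<^sup>2 / 2))"
    using fin by (simp only: char_gauss exp_sum of_real_prod)
  also have "(\<Sum>b\<in>B. - (w \<bullet> b)\<^sup>2 / 2) = - (w \<bullet> (\<Sum>b\<in>B. (w \<bullet> b) *\<^sub>R b)) / 2"
    by (simp add: inner_sum_right power2_eq_square sum_negf sum_divide_distrib)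
  also have "(\<Sum>b\<in>B. (w \<bullet> b) *\<^sub>R b) = w"
    using w B fin by (intro orthonormal_basis_expand) auto
  finally show "(LINT v|(std_gaussian_on L). iexp (w \<bullet> v)) = of_real (exp (- (w \<bullet> w) / 2))" .
qed

text \<open>A solid angle refers to the linear hull of the cone itself, so this hull has to be
  identified. Far enough in the direction of a strictly interior point \<open>p\<close> every
  \<open>v \<in> L\<close> enters the cone, which exhibits \<open>v\<close> as a combination of two
  of its elements.\<close>

lemma span_polyhedral_cone:
  fixes w :: "'i \<Rightarrow> 'a::euclidean_space"
  assumes L: "subspace L" and C: "C = {v \<in> L. \<forall>j\<in>J. w j \<bullet> v \<le> 0}"
    and J: "finite J" and p: "p \<in> L" "\<And>j. j \<in> J \<Longrightarrow> w j \<bullet> p < 0"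
  shows "span C = L"
proof
  show "span C \<subseteq> L"
    using L C by (intro span_minimal) auto
  show "L \<subseteq> span C"
  proof
    fix v assume v: "v \<in> L"
    \<comment> \<open>The sum dominates each of the required quotients and, unlike a maximum, also
      makes sense for empty \<open>J\<close>.\<close>
    define N where "N = (\<Sum>j\<in>J. \<bar>w j \<bullet> v\<bar> / - (w j \<bullet> p))"
    have "w j \<bullet> (v + N *\<^sub>R p) \<le> 0" if j: "j \<in> J" for j
    proof -
      have "\<bar>w j \<bullet> v\<bar> / - (w j \<bullet> p) \<le> N"
        unfolding N_def using p by (intro member_le_sum J j divide_nonneg_pos) auto
      then have "\<bar>w j \<bullet> v\<bar> \<le> N * - (w j \<bullet> p)"
        using p(2)[OF j] by (simp add: field_simps)
      then show ?thesis by (simp add: inner_add_right)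
    qed
    moreover have "N \<ge> 0"
      unfolding N_def using p(2) by (intro sum_nonneg divide_nonneg_pos) auto
    ultimately have "v + N *\<^sub>R p \<in> C" "p \<in> C"
      using v p L C by (auto intro: subspace_add subspace_scale less_imp_le)
    then have "(v + N *\<^sub>R p) - N *\<^sub>R p \<in> span C"
      by (intro span_diff span_scale span_base)
    then show "v \<in> span C" by simp
  qed
qed

lemma solid_angle_eq_g_fun:
  fixes w :: "nat \<Rightarrow> 'a::euclidean_space"
  assumes L: "subspace L" and C: "C = {v \<in> L. \<forall>j\<in>{1..l}. w j \<bullet> v \<le> 0}"
    and w: "\<And>j. j \<in> {1..l} \<Longrightarrow> w j \<in> L"
    and cov: "\<And>i j. i \<in> {1..l} \<Longrightarrow> j \<in> {1..l} \<Longrightarrow> w i \<bullet> w j = 1 / lam0 + (if i = j then 1 / lam i else 0)"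
    and pos: "\<And>j. j \<in> {1..l} \<Longrightarrow> lam j > 0" and lam0: "lam0 > 0 \<or> lam0 < - (\<Sum>j=1..l. lam j)"
  shows "solid_angle C = g_fun l lam0 lam (\<lambda>_. 1)"
proof -
  interpret prob_space "std_gaussian_on L" by (rule prob_space_std_gaussian_on[OF L])
  note [measurable_cong] = sets_std_gaussian_on[OF L]
  have sp: "space (std_gaussian_on L) = UNIV"
    using sets_eq_imp_space_eq[OF sets_std_gaussian_on[OF L]] by simp
  define J where "J = {1..l}"
  \<comment> \<open>An interior point of the cone: \<open>w j \<bullet> p = - ((\<Sum>i\<in>J. lam i) + lam0) / lam0\<close>.\<close>
  define p where "p = - (\<Sum>i\<in>J. lam i *\<^sub>R w i)"
  have pL: "p \<in> L"
    unfolding p_def using L w by (auto simp: J_def intro!: subspace_neg subspace_sum subspace_scale)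
  have wp: "w j \<bullet> p < 0" if j: "j \<in> J" for j
  proof -
    have "w j \<bullet> p = - (\<Sum>i\<in>J. lam i * (1 / lam0 + (if j = i then 1 / lam j else 0)))"
      using j cov unfolding p_def J_def by (simp add: inner_sum_right del: One_nat_def)
    also have "(\<Sum>i\<in>J. lam i * (1 / lam0 + (if j = i then 1 / lam j else 0)))
        = (\<Sum>i\<in>J. lam i / lam0 + (if j = i then 1 else 0))"
      using pos[of j] j by (intro sum.cong) (auto simp: J_def distrib_left)
    also have "\<dots> = (\<Sum>i\<in>J. lam i) / lam0 + 1"
      using j by (simp add: J_def sum.distrib sum_divide_distrib)
    \<comment> \<open>Under either alternative for \<open>lam0\<close>, the numbers
      \<open>lam0\<close> and \<open>lam0 + (\<Sum>i\<in>J. lam i)\<close> have the same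
      sign.\<close>
    also have "- \<dots> < 0"
    proof -
      have "(\<Sum>i\<in>J. lam i) > 0"
        using j pos by (intro sum_pos) (auto simp: J_def)
      then show ?thesis
        using lam0 unfolding J_def[symmetric] by (auto simp: add_pos_pos field_simps)
    qed
    finally show ?thesis .
  qed
  have span: "span C = L"
    using span_polyhedral_cone[OF L C[folded J_def], OF _ pL wp] by (simp add: J_def)
  \<comment> \<open>Without the constraint \<open>v \<in> L\<close> the set is a preimage under the
    map to coordinates; the law gives full mass to \<open>L\<close>, so the measure is
    unchanged.\<close>
  define A where "A = {v. \<forall>j\<in>J. w j \<bullet> v \<le> 0}"
  have [measurable]: "L \<in> sets borel"
    using closed_subspace[OF L] by auto
  have A[measurable]: "A \<in> sets borel"
    unfolding A_def J_def by measurable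
  have C_A: "C = A \<inter> L"
    unfolding C A_def J_def by auto
  have "solid_angle C = measure (std_gaussian_on L) A"
    unfolding solid_angle_def span using AE_std_gaussian_on[OF L]
    by (intro finite_measure_eq_AE) (auto simp: C_A sets_std_gaussian_on[OF L])
  also have "\<dots> = g_fun l lam0 lam (\<lambda>_. 1)"
  proof (cases "l = 0")
    case True
    then show ?thesis
      using prob_space by (simp add: A_def J_def g_fun_def sp)
  next
    case False
    define M where "M = distr (std_gaussian_on L) (\<Pi>\<^sub>M j\<in>J. borel) (\<lambda>v. \<lambda>j\<in>J. w j \<bullet> v)"
    have map[measurable]: "(\<lambda>v. \<lambda>j\<in>J. w j \<bullet> v) \<in> std_gaussian_on L \<rightarrow>\<^sub>M (\<Pi>\<^sub>M j\<in>J. borel)"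
      by measurable
    have "is_centered_gaussian J (\<lambda>i j. 1 / lam0 + (if i = j then 1 / lam i else 0)) M"
      unfolding is_centered_gaussian_def
    proof (intro conjI allI)
      show "prob_space M"
        unfolding M_def by (rule prob_space_distr) measurable
      show "sets M = sets (\<Pi>\<^sub>M j\<in>J. borel)"
        by (simp add: M_def)
      fix t :: "nat \<Rightarrow> real"
      define u where "u = (\<Sum>j\<in>J. t j *\<^sub>R w j)"
      have u: "u \<in> L"
        unfolding u_def using L w by (auto simp: J_def intro!: subspace_sum subspace_scale)
      have "(LINT x|M. iexp (\<Sum>i\<in>J. t i * x i)) = (LINT v|(std_gaussian_on L). iexp (\<Sum>i\<in>J. t i * (w i \<bullet> v)))"
        unfolding M_def by (subst integral_distr) (auto cong: sum.cong)
      also have "\<dots> = (LINT v|(std_gaussian_on L). iexp (u \<bullet> v))"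
        by (simp add: u_def inner_sum_left)
      also have "\<dots> = of_real (exp (- (u \<bullet> u) / 2))"
        by (rule char_std_gaussian_on[OF L u])
      also have "u \<bullet> u = (\<Sum>i\<in>J. \<Sum>j\<in>J. t i * t j * (1 / lam0 + (if i = j then 1 / lam i else 0)))"
      proof -
        have "u \<bullet> u = (\<Sum>i\<in>J. \<Sum>j\<in>J. t i * t j * (w j \<bullet> w i))"
          by (simp add: u_def inner_sum_left inner_sum_right sum_distrib_left mult.assoc)
        then show ?thesis
          using cov by (auto simp: J_def intro!: sum.cong)
      qed
      finally show "(LINT x|M. iexp (\<Sum>i\<in>J. t i * x i)) = of_real (exp (- (\<Sum>i\<in>J. \<Sum>j\<in>J. t i * t j * (1 / lam0 + (if i = j then 1 / lam i else 0))) / 2))" .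
    qed
    then have "centered_gaussian J (\<lambda>i j. 1 / lam0 + (if i = j then 1 / lam i else 0)) = M"
      by (intro centered_gaussian_eqI) (auto simp: J_def)
    then have "g_fun l lam0 lam (\<lambda>_. 1) = measure M {\<eta> \<in> space M. \<forall>j\<in>J. \<eta> j \<le> 0}"
      using False by (simp add: g_fun_def J_def Let_def)
    also have "\<dots> = measure (std_gaussian_on L) A"
      unfolding M_def
    proof (subst measure_distr[OF map])
      show "{\<eta> \<in> space (distr (std_gaussian_on L) (\<Pi>\<^sub>M j\<in>J. borel) (\<lambda>v. \<lambda>j\<in>J. w j \<bullet> v)). \<forall>j\<in>J. \<eta> j \<le> 0} \<in> sets (\<Pi>\<^sub>M j\<in>J. borel)"
        unfolding space_distr J_def by measurable
    qed (auto simp: A_def sp space_PiM intro!: arg_cong[where f = "measure (std_gaussian_on L)"])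
    finally show ?thesis by simp
  qed
  finally show ?thesis .
qed

text \<open>The bijection \<open>e\<close> onto \<open>Basis\<close> both forces the dimension d+1
  of the ambient space and numbers its standard basis from 0.\<close>

locale weighted_simplex =
  fixes d k :: nat and \<tau> :: "nat \<Rightarrow> real" and e :: "nat \<Rightarrow> 'a::euclidean_space" and S F :: "'a set"
  assumes \<tau>_pos: "\<And>i. i \<le> d \<Longrightarrow> \<tau> i > 0"
    and e_Basis: "bij_betw e {0..d} Basis"
    and S_def: "S = convex hull ((\<lambda>i. e i /\<^sub>R \<tau> i) ` {0..d})"
    and k_le: "k \<le> d"
    and F_def: "F = convex hull ((\<lambda>i. e i /\<^sub>R \<tau> i) ` {0..k})"
begin

lemma e_inner: "i \<le> d \<Longrightarrow> j \<le> d \<Longrightarrow> e i \<bullet> e j = (if i = j then 1 else 0)"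
  using bij_betwE[OF e_Basis] bij_betw_imp_inj_on[OF e_Basis]
  by (auto simp: inner_Basis inj_on_def)

lemma inner_e_sum:
  assumes "K \<subseteq> {0..d}" "j \<le> d"
  shows "(\<Sum>i\<in>K. c i *\<^sub>R e i) \<bullet> e j = (if j \<in> K then c j else 0)"
proof -
  have "(\<Sum>i\<in>K. c i *\<^sub>R e i) \<bullet> e j = (\<Sum>i\<in>K. if j = i then c i else 0)"
    unfolding inner_sum_left using assms by (intro sum.cong) (auto simp: e_inner)
  then show ?thesis
    using finite_subset[OF assms(1)] by simp
qed

lemma inner_expand: "x \<bullet> y = (\<Sum>i=0..d. (x \<bullet> e i) * (y \<bullet> e i))"
  unfolding euclidean_inner[of x y] using sum.reindex_bij_betw[OF e_Basis, of "\<lambda>b. (x \<bullet> b) * (y \<bullet> b)"] by simp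

lemma e_expand: "(\<Sum>i=0..d. (x \<bullet> e i) *\<^sub>R e i) = x"
  using sum.reindex_bij_betw[OF e_Basis, of "\<lambda>b. (x \<bullet> b) *\<^sub>R b"] by (simp add: euclidean_representation)

text \<open>The numbers \<open>\<tau> i * (x \<bullet> e i)\<close> are the barycentric coordinates
  of \<open>x\<close> with respect to the vertices.\<close>

lemma S_eq: "S = {x. (\<forall>i\<le>d. 0 \<le> x \<bullet> e i) \<and> (\<Sum>i=0..d. \<tau> i * (x \<bullet> e i)) = 1}" (is "_ = ?R")
proof
  have "convex ?R"
    unfolding convex_def
  proof safe
    fix x y u v i assume *: "\<forall>i\<le>d. 0 \<le> x \<bullet> e i" "\<forall>i\<le>d. 0 \<le> y \<bullet> e i" "0 \<le> (u::real)" "0 \<le> v"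
      and uv: "u + v = 1" and x: "(\<Sum>i = 0..d. \<tau> i * (x \<bullet> e i)) = 1" and y: "(\<Sum>i = 0..d. \<tau> i * (y \<bullet> e i)) = 1"
    show "i \<le> d \<Longrightarrow> 0 \<le> (u *\<^sub>R x + v *\<^sub>R y) \<bullet> e i"
      using * by (simp add: inner_add_left)
    have "(\<Sum>i = 0..d. \<tau> i * ((u *\<^sub>R x + v *\<^sub>R y) \<bullet> e i))
        = u * (\<Sum>i = 0..d. \<tau> i * (x \<bullet> e i)) + v * (\<Sum>i = 0..d. \<tau> i * (y \<bullet> e i))"
      by (simp add: inner_add_left algebra_simps sum.distrib sum_distrib_left)
    then show "(\<Sum>i = 0..d. \<tau> i * ((u *\<^sub>R x + v *\<^sub>R y) \<bullet> e i)) = 1"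
      using x y uv by simp
  qed
  moreover have "e i /\<^sub>R \<tau> i \<in> ?R" if "i \<le> d" for i
  proof -
    have "(\<Sum>j = 0..d. \<tau> j * ((e i /\<^sub>R \<tau> i) \<bullet> e j)) = (\<Sum>j = 0..d. if i = j then 1 else 0)"
      using that \<tau>_pos[OF that] by (intro sum.cong) (auto simp: e_inner)
    then show ?thesis
      using that \<tau>_pos[OF that] by (auto simp: e_inner)
  qed
  ultimately show "S \<subseteq> ?R"
    unfolding S_def by (intro hull_minimal) auto
  show "?R \<subseteq> S"
  proof
    fix x assume x: "x \<in> ?R"
    have "(\<Sum>i\<in>{0..d}. (\<tau> i * (x \<bullet> e i)) *\<^sub>R (e i /\<^sub>R \<tau> i)) \<in> S"
      unfolding S_def using x \<tau>_pos
      by (intro convex_sum) (auto intro!: hull_inc mult_nonneg_nonneg simp: less_imp_le)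
    also have "(\<Sum>i\<in>{0..d}. (\<tau> i * (x \<bullet> e i)) *\<^sub>R (e i /\<^sub>R \<tau> i)) = (\<Sum>i=0..d. (x \<bullet> e i) *\<^sub>R e i)"
    proof (intro sum.cong refl)
      fix i assume "i \<in> {0..d}"
      then show "(\<tau> i * (x \<bullet> e i)) *\<^sub>R (e i /\<^sub>R \<tau> i) = (x \<bullet> e i) *\<^sub>R e i"
        using \<tau>_pos[of i] by simp
    qed
    finally show "x \<in> S" by (simp add: e_expand)
  qed
qed

text \<open>The barycentre of \<open>F\<close>, with weight 1/(k+1) on each vertex; it is the base
  point for both cones.\<close>

definition center :: 'a where
  "center = (\<Sum>i\<in>{0..k}. (1 / (real (Suc k) * \<tau> i)) *\<^sub>R e i)"

lemma center_inner: "i \<le> d \<Longrightarrow> center \<bullet> e i = (if i \<le> k then 1 / (real (Suc k) * \<tau> i) else 0)"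
  unfolding center_def using k_le by (subst inner_e_sum) auto

text \<open>The vertices are distinct, nonzero and pairwise orthogonal, hence affinely independent,
  and the relative interior consists of the convex combinations with strictly positive
  weights.\<close>

lemma center_rel_interior: "center \<in> rel_interior F"
proof -
  let ?p = "\<lambda>i. e i /\<^sub>R \<tau> i"
  have inner_p: "?p i \<bullet> ?p j = (if i = j then 1 / (\<tau> i)\<^sup>2 else 0)" if "i \<le> k" "j \<le> k" for i j
    using that k_le \<tau>_pos[of i] by (auto simp: e_inner field_simps power2_eq_square)
  have inj: "inj_on ?p {0..k}"
  proof (rule inj_onI, rule ccontr)
    fix i j assume ij: "i \<in> {0..k}" "j \<in> {0..k}" "?p i = ?p j" "i \<noteq> j"
    have "?p i \<bullet> ?p j = 0" "?p i \<bullet> ?p i = 1 / (\<tau> i)\<^sup>2"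
      using inner_p[of i j] inner_p[of i i] ij(1,2,4) by auto
    then have "1 / (\<tau> i)\<^sup>2 = 0"
      by (metis ij(3))
    then show False using ij(1) k_le \<tau>_pos[of i] by simp
  qed
  have "independent (?p ` {0..k})"
  proof (rule pairwise_orthogonal_independent)
    show "pairwise orthogonal (?p ` {0..k})"
      unfolding pairwise_def orthogonal_def using inner_p by fastforce
    show "0 \<notin> ?p ` {0..k}"
    proof
      assume "0 \<in> ?p ` {0..k}"
      then obtain i where "i \<le> k" "?p i = 0" by auto
      then show False using inner_p[of i i] k_le \<tau>_pos[of i] by simp
    qed
  qed
  then have "\<not> affine_dependent (?p ` {0..k})"
    using affine_dependent_imp_dependent by blast
  moreover have "(\<Sum>x\<in>?p ` {0..k}. (1 / real (Suc k)) *\<^sub>R x) = center"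
    unfolding center_def by (subst sum.reindex[OF inj]) (simp add: mult.commute divide_inverse)
  moreover have "(\<Sum>x\<in>?p ` {0..k}. 1 / real (Suc k)) = 1"
    using inj by (simp add: card_image)
  ultimately show ?thesis
    unfolding F_def by (subst rel_interior_convex_hull_explicit) (auto intro!: exI[of _ "\<lambda>_. 1 / real (Suc k)"])
qed

lemma F_subset_S: "F \<subseteq> S"
  unfolding S_def F_def using k_le by (intro hull_mono image_mono) auto

lemma center_S: "center \<in> S"
  using center_rel_interior rel_interior_subset F_subset_S by blast

text \<open>At the barycentre the coordinates 0, ..., k are positive, so their sign conditions do
  not restrict directions; the linear equation and the conditions on the vanishing coordinates
  remain.\<close>

lemma tangent_cone_F_S:
  "tangent_cone F S = {v. (\<Sum>i=0..d. \<tau> i * (v \<bullet> e i)) = 0 \<and> (\<forall>i\<in>{k<..d}. 0 \<le> v \<bullet> e i)}" (is "_ = ?R")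
proof -
  have "tangent_cone F S = {v. \<exists>\<epsilon>>0. center + \<epsilon> *\<^sub>R v \<in> S}"
    by (rule tangent_cone_eq[OF _ _ F_subset_S center_rel_interior]) (auto simp: F_def S_def)
  also have "\<dots> = ?R"
  proof (intro equalityI subsetI CollectI; elim CollectE conjE exE)
    have sum_eq: "(\<Sum>i=0..d. \<tau> i * ((center + \<epsilon> *\<^sub>R v) \<bullet> e i)) = 1 + \<epsilon> * (\<Sum>i=0..d. \<tau> i * (v \<bullet> e i))" for \<epsilon> v
    proof -
      have "(\<Sum>i=0..d. \<tau> i * ((center + \<epsilon> *\<^sub>R v) \<bullet> e i))
          = (\<Sum>i=0..d. \<tau> i * (center \<bullet> e i)) + \<epsilon> * (\<Sum>i=0..d. \<tau> i * (v \<bullet> e i))"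
        by (simp add: inner_add_left algebra_simps sum.distrib sum_distrib_left)
      then show ?thesis using center_S unfolding S_eq by simp
    qed
    { fix v \<epsilon> assume \<epsilon>: "\<epsilon> > 0" "center + \<epsilon> *\<^sub>R v \<in> S"
      then have "(\<Sum>i=0..d. \<tau> i * (v \<bullet> e i)) = 0"
        using sum_eq[of \<epsilon> v] unfolding S_eq by simp
      moreover have "0 \<le> v \<bullet> e i" if "i \<in> {k<..d}" for i
      proof -
        have "0 \<le> (center + \<epsilon> *\<^sub>R v) \<bullet> e i"
          using \<epsilon> that unfolding S_eq by auto
        then show ?thesis
          using \<epsilon>(1) that by (simp add: inner_add_left center_inner zero_le_mult_iff)
      qed
      ultimately show "(\<Sum>i=0..d. \<tau> i * (v \<bullet> e i)) = 0 \<and> (\<forall>i\<in>{k<..d}. 0 \<le> v \<bullet> e i)"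
        by blast }
    { fix v assume v0: "(\<Sum>i=0..d. \<tau> i * (v \<bullet> e i)) = 0" and v: "\<forall>i\<in>{k<..d}. 0 \<le> v \<bullet> e i"
      \<comment> \<open>\<open>D\<close> bounds the ratio of each coordinate of \<open>v\<close> on
        the face to that of the barycentre, so the step length \<open>1 / (1 + D)\<close> keeps
        these coordinates nonnegative; the summand 1 excludes division by 0.\<close>
      define D where "D = (\<Sum>i\<in>{0..k}. \<bar>v \<bullet> e i\<bar> / (center \<bullet> e i))"
      have c_pos: "center \<bullet> e i > 0" if "i \<le> k" for i
        using that k_le \<tau>_pos[of i] by (simp add: center_inner)
      have D: "D \<ge> 0"
        unfolding D_def using c_pos by (intro sum_nonneg divide_nonneg_pos) auto
      have "0 \<le> (center + (1 / (1 + D)) *\<^sub>R v) \<bullet> e i" if i: "i \<le> d" for i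
      proof (cases "i \<le> k")
        case True
        have "\<bar>v \<bullet> e i\<bar> / (center \<bullet> e i) \<le> D"
          unfolding D_def using c_pos True by (intro member_le_sum divide_nonneg_pos) auto
        then have "\<bar>v \<bullet> e i\<bar> \<le> (1 + D) * (center \<bullet> e i)"
          using c_pos[OF True] by (simp add: field_simps)
        then have "- (v \<bullet> e i) \<le> (1 + D) * (center \<bullet> e i)"
          by linarith
        then show ?thesis
          using D by (simp add: inner_add_left field_simps)
      next
        case False
        then show ?thesis
          using D v i by (simp add: inner_add_left center_inner)
      qed
      then have "center + (1 / (1 + D)) *\<^sub>R v \<in> S"
        unfolding S_eq using sum_eq[of "1 / (1 + D)" v] v0 by auto
      then show "\<exists>\<epsilon>>0. center + \<epsilon> *\<^sub>R v \<in> S"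
        using D by (intro exI[of _ "1 / (1 + D)"]) auto }
  qed
  finally show ?thesis .
qed

text \<open>A normal vector is a linear functional that attains its maximum over \<open>S\<close> at
  the barycentre of \<open>F\<close>. Its values at the vertices are
  \<open>v \<bullet> e i / \<tau> i\<close>; those on \<open>F\<close> must all equal the maximum,
  and vertex 0 serves as the reference.\<close>

lemma normal_cone_F_S:
  "normal_cone F S = {v. (\<forall>i\<le>k. v \<bullet> e i / \<tau> i = v \<bullet> e 0 / \<tau> 0) \<and> (\<forall>i\<in>{k<..d}. v \<bullet> e i / \<tau> i \<le> v \<bullet> e 0 / \<tau> 0)}" (is "_ = ?R")
proof -
  have v_center: "v \<bullet> center = (\<Sum>i\<in>{0..k}. v \<bullet> e i / \<tau> i) / real (Suc k)" for v
    unfolding center_def by (simp add: inner_sum_right sum_divide_distrib mult.commute)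
  have "normal_cone F S = {v. \<forall>z\<in>S. v \<bullet> (z - center) \<le> 0}"
    by (rule normal_cone_eq[OF _ F_subset_S center_rel_interior]) (auto simp: F_def)
  also have "\<dots> = ?R"
  proof (intro equalityI subsetI CollectI; elim CollectE conjE)
    { fix v assume *: "\<forall>z\<in>S. v \<bullet> (z - center) \<le> 0"
      have le: "v \<bullet> e i / \<tau> i \<le> v \<bullet> center" if "i \<le> d" for i
      proof -
        have "e i /\<^sub>R \<tau> i \<in> S"
          unfolding S_def using that by (intro hull_inc) auto
        with * have "v \<bullet> (e i /\<^sub>R \<tau> i - center) \<le> 0" by blast
        then show ?thesis by (simp add: inner_diff_right divide_inverse mult.commute)
      qed
      \<comment> \<open>The value at the barycentre is the mean of the values at the vertices of
        \<open>F\<close>, none of which exceeds it; hence all of them are equal to it.\<close>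
      have "(\<Sum>i\<in>{0..k}. v \<bullet> center - v \<bullet> e i / \<tau> i) = 0"
        unfolding sum_subtractf using v_center[of v] by simp
      then have eq: "v \<bullet> e i / \<tau> i = v \<bullet> center" if "i \<le> k" for i
        using le k_le that by (subst (asm) sum_nonneg_eq_0_iff) auto
      show "(\<forall>i\<le>k. v \<bullet> e i / \<tau> i = v \<bullet> e 0 / \<tau> 0) \<and> (\<forall>i\<in>{k<..d}. v \<bullet> e i / \<tau> i \<le> v \<bullet> e 0 / \<tau> 0)"
        using le eq eq[of 0] by simp }
    { fix v assume 1: "\<forall>i\<le>k. v \<bullet> e i / \<tau> i = v \<bullet> e 0 / \<tau> 0" and 2: "\<forall>i\<in>{k<..d}. v \<bullet> e i / \<tau> i \<le> v \<bullet> e 0 / \<tau> 0"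
      define c where "c = v \<bullet> e 0 / \<tau> 0"
      have "(\<Sum>i\<in>{0..k}. v \<bullet> e i / \<tau> i) = (\<Sum>i\<in>{0..k}. c)"
        using 1 unfolding c_def by (intro sum.cong refl) (meson atLeastAtMost_iff)
      then have "v \<bullet> center = c"
        unfolding v_center by simp
      moreover have "v \<bullet> z \<le> c" if z: "z \<in> S" for z
      proof -
        have "v \<bullet> z = (\<Sum>i=0..d. (v \<bullet> e i) * (z \<bullet> e i))"
          by (rule inner_expand)
        also have "\<dots> \<le> (\<Sum>i=0..d. c * (\<tau> i * (z \<bullet> e i)))"
        proof (rule sum_mono)
          fix i assume i: "i \<in> {0..d}"
          have "v \<bullet> e i / \<tau> i \<le> c"
          proof (cases "i \<le> k")
            case True
            then show ?thesis
              using 1[rule_format, OF True] by (simp only: c_def)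
          next
            case False
            with i have "i \<in> {k<..d}" by simp
            then show ?thesis
              using 2 unfolding c_def by blast
          qed
          then have "v \<bullet> e i \<le> c * \<tau> i"
            using i \<tau>_pos[of i] by (simp add: field_simps)
          then have "(v \<bullet> e i) * (z \<bullet> e i) \<le> (c * \<tau> i) * (z \<bullet> e i)"
            using z i unfolding S_eq by (intro mult_right_mono) auto
          then show "(v \<bullet> e i) * (z \<bullet> e i) \<le> c * (\<tau> i * (z \<bullet> e i))"
            by (simp add: mult.assoc)
        qed
        also have "\<dots> = c"
          using z unfolding S_eq by (simp flip: sum_distrib_left)
        finally show ?thesis .
      qed
      ultimately show "\<forall>z\<in>S. v \<bullet> (z - center) \<le> 0"
        by (simp add: inner_diff_right) }
  qed
  finally show ?thesis .
qed

lemma face_index: "(\<forall>i\<in>{k<..d}. P i) \<longleftrightarrow> (\<forall>j\<in>{1..d - k}. P (k + j))"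
proof safe
  fix i assume *: "\<forall>j\<in>{1..d - k}. P (k + j)" "i \<in> {k<..d}"
  then have "i - k \<in> {1..d - k}" by auto
  then have "P (k + (i - k))" using * by blast
  then show "P i" using *(2) by simp
qed auto

lemma face_index_pos: "j \<in> {1..d - k} \<Longrightarrow> k + j \<le> d \<and> 0 < \<tau> (k + j)"
  using \<tau>_pos[of "k + j"] k_le by auto

text \<open>The linear hull is the hyperplane orthogonal to \<open>T\<close>, and \<open>w j\<close>
  is the orthogonal projection of \<open>- e (k + j) /\<^sub>R \<tau> (k + j)\<close> onto it. As
  \<open>T \<bullet> T = Q\<close>, the projection subtracts \<open>1 / Q\<close> from every entry
  of the diagonal Gram matrix.\<close>

lemma internal_angle_F_S:
  "internal_angle F S = g_fun (d - k) (- (\<Sum>i=0..d. (\<tau> i)\<^sup>2)) (\<lambda>j. (\<tau> (k + j))\<^sup>2) (\<lambda>_. 1)"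
  unfolding internal_angle_def
proof (rule solid_angle_eq_g_fun)
  define T where "T = (\<Sum>i\<in>{0..d}. \<tau> i *\<^sub>R e i)"
  define Q where "Q = (\<Sum>i=0..d. (\<tau> i)\<^sup>2)"
  define w where "w j = T /\<^sub>R Q - e (k + j) /\<^sub>R \<tau> (k + j)" for j
  have T_e: "T \<bullet> e i = \<tau> i" if "i \<le> d" for i
    unfolding T_def using that by (subst inner_e_sum) auto
  have T_v: "T \<bullet> v = (\<Sum>i=0..d. \<tau> i * (v \<bullet> e i))" for v
    unfolding T_def inner_sum_left by (simp add: inner_commute)
  have Q: "Q > 0"
    unfolding Q_def using \<tau>_pos by (intro sum_pos) (auto simp: less_imp_neq[symmetric])
  have T_T: "T \<bullet> T = Q"
    by (subst T_v, unfold Q_def, intro sum.cong) (auto simp: T_e power2_eq_square)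
  have w_v: "w j \<bullet> v = - (v \<bullet> e (k + j) / \<tau> (k + j))" if "T \<bullet> v = 0" for j v
    using that by (simp add: w_def inner_diff_left inner_commute[of v] divide_inverse mult.commute)
  show "subspace {v. T \<bullet> v = 0}"
    by (rule subspace_hyperplane)
  show "w j \<in> {v. T \<bullet> v = 0}" if "j \<in> {1..d - k}" for j
  proof -
    have "k + j \<le> d" using that k_le by auto
    then show ?thesis
      using Q \<tau>_pos[of "k + j"] by (simp add: w_def inner_diff_right T_T T_e)
  qed
  then show "w i \<bullet> w j = 1 / - (\<Sum>i=0..d. (\<tau> i)\<^sup>2) + (if i = j then 1 / (\<tau> (k + i))\<^sup>2 else 0)"
    if "i \<in> {1..d - k}" "j \<in> {1..d - k}" for i j
    unfolding Q_def[symmetric]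
    using Q that face_index_pos[of i] face_index_pos[of j]
    by (subst w_v) (auto simp: w_def inner_diff_left T_e e_inner field_simps power2_eq_square)
  show "tangent_cone F S = {v \<in> {v. T \<bullet> v = 0}. \<forall>j\<in>{1..d - k}. w j \<bullet> v \<le> 0}"
  proof -
    have "w j \<bullet> v \<le> 0 \<longleftrightarrow> 0 \<le> v \<bullet> e (k + j)" if "T \<bullet> v = 0" "j \<in> {1..d - k}" for v j
      using face_index_pos[OF that(2)] by (simp add: w_v[OF that(1)] zero_le_divide_iff)
    then show ?thesis
      unfolding tangent_cone_F_S T_v[symmetric] face_index by blast
  qed
  show "0 < (\<tau> (k + j))\<^sup>2" if "j \<in> {1..d - k}" for j
    using face_index_pos[OF that] by simp
  have "(\<Sum>j=1..d - k. (\<tau> (k + j))\<^sup>2) = (\<Sum>i\<in>(\<lambda>j. k + j) ` {1..d - k}. (\<tau> i)\<^sup>2)"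
    by (subst sum.reindex) auto
  \<comment> \<open>The index 0 never has the form \<open>k + j\<close> with
    \<open>j \<ge> 1\<close>, so \<open>(\<tau> 0)\<^sup>2\<close> makes the inequality
    strict.\<close>
  also have "\<dots> < Q"
    unfolding Q_def using k_le \<tau>_pos[of 0] by (intro sum_strict_mono2[of _ _ 0]) auto
  finally show "- (\<Sum>i = 0..d. (\<tau> i)\<^sup>2) > 0 \<or> - (\<Sum>i=0..d. (\<tau> i)\<^sup>2) < - (\<Sum>j=1..d - k. (\<tau> (k + j))\<^sup>2)"
    by (simp add: Q_def)
qed

text \<open>The linear hull consists of the vectors whose coordinates 0, ..., k are proportional to
  \<tau>, and on it the common ratio is \<open>(T \<bullet> v) / Q\<close>. Subtracting
  \<open>T /\<^sub>R Q\<close> thus encodes the comparison with vertex 0 by a vector inside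
  \<open>L\<close>. Since \<open>T\<close> is orthogonal to the remaining basis vectors, it adds
  \<open>1 / Q\<close> to every Gram entry.\<close>

lemma external_angle_F_S:
  "external_angle F S = g_fun (d - k) (\<Sum>i=0..k. (\<tau> i)\<^sup>2) (\<lambda>j. (\<tau> (k + j))\<^sup>2) (\<lambda>_. 1)"
  unfolding external_angle_def
proof (rule solid_angle_eq_g_fun)
  define T where "T = (\<Sum>i\<in>{0..k}. \<tau> i *\<^sub>R e i)"
  define Q where "Q = (\<Sum>i=0..k. (\<tau> i)\<^sup>2)"
  define L where "L = {v. \<forall>i\<le>k. v \<bullet> e i / \<tau> i = v \<bullet> e 0 / \<tau> 0}"
  define w where "w j = e (k + j) /\<^sub>R \<tau> (k + j) - T /\<^sub>R Q" for j
  have T_e: "T \<bullet> e i = (if i \<le> k then \<tau> i else 0)" if "i \<le> d" for i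
    unfolding T_def using that k_le by (subst inner_e_sum) auto
  have Q: "Q > 0"
    unfolding Q_def using \<tau>_pos k_le by (intro sum_pos) (auto simp: less_imp_neq[symmetric])
  then show "(\<Sum>i=0..k. (\<tau> i)\<^sup>2) > 0 \<or> (\<Sum>i=0..k. (\<tau> i)\<^sup>2) < - (\<Sum>j=1..d - k. (\<tau> (k + j))\<^sup>2)"
    by (simp add: Q_def)
  have T_v: "T \<bullet> v = Q * (v \<bullet> e 0 / \<tau> 0)" if "v \<in> L" for v
  proof -
    have ratio: "v \<bullet> e i / \<tau> i = v \<bullet> e 0 / \<tau> 0" if "i \<le> k" for i
      using \<open>v \<in> L\<close> that unfolding L_def mem_Collect_eq by (elim allE impE)
    have "T \<bullet> v = (\<Sum>i=0..k. \<tau> i * (v \<bullet> e i))"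
      unfolding T_def inner_sum_left by (simp add: inner_commute)
    also have "\<dots> = (\<Sum>i=0..k. (\<tau> i)\<^sup>2 * (v \<bullet> e 0 / \<tau> 0))"
    proof (rule sum.cong[OF refl])
      fix i assume "i \<in> {0..k}"
      then have "i \<le> k" "\<tau> i > 0"
        using \<tau>_pos[of i] k_le by auto
      then show "\<tau> i * (v \<bullet> e i) = (\<tau> i)\<^sup>2 * (v \<bullet> e 0 / \<tau> 0)"
        by (subst ratio[of i, symmetric]) (simp_all add: power2_eq_square)
    qed
    finally show ?thesis
      by (simp add: Q_def sum_distrib_right sum_divide_distrib)
  qed
  have w_v: "w j \<bullet> v = v \<bullet> e (k + j) / \<tau> (k + j) - v \<bullet> e 0 / \<tau> 0" if "v \<in> L" for j v
    using Q T_v[OF that] by (simp add: w_def inner_diff_left inner_commute[of v] divide_inverse mult.commute)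
  show "subspace L"
  proof (rule subspaceI)
    show "x + y \<in> L" if "x \<in> L" "y \<in> L" for x y
      using that unfolding L_def mem_Collect_eq inner_add_left add_divide_distrib by metis
    show "c *\<^sub>R x \<in> L" if "x \<in> L" for c x
      using that unfolding L_def mem_Collect_eq inner_scaleR_left times_divide_eq_right[symmetric] by metis
  qed (simp add: L_def)
  show w_L: "w j \<in> L" if "j \<in> {1..d - k}" for j
    using that k_le by (auto simp: L_def w_def inner_diff_left T_e e_inner less_imp_neq[OF \<tau>_pos, symmetric])
  show "w i \<bullet> w j = 1 / (\<Sum>i=0..k. (\<tau> i)\<^sup>2) + (if i = j then 1 / (\<tau> (k + i))\<^sup>2 else 0)"
    if "i \<in> {1..d - k}" "j \<in> {1..d - k}" for i j
    unfolding Q_def[symmetric] w_v[OF w_L[OF that(2)]]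
    using that face_index_pos[of i] face_index_pos[of j] \<tau>_pos[of 0] Q
    by (auto simp: w_def inner_diff_left T_e e_inner field_simps power2_eq_square)
  show "normal_cone F S = {v \<in> L. \<forall>j\<in>{1..d - k}. w j \<bullet> v \<le> 0}"
  proof -
    have "normal_cone F S = {v \<in> L. \<forall>j\<in>{1..d - k}. v \<bullet> e (k + j) / \<tau> (k + j) \<le> v \<bullet> e 0 / \<tau> 0}"
      unfolding normal_cone_F_S face_index L_def mem_Collect_eq ..
    also have "\<dots> = {v \<in> L. \<forall>j\<in>{1..d - k}. w j \<bullet> v \<le> 0}"
      by (intro Collect_cong conj_cong refl) (simp add: w_v)
    finally show ?thesis .
  qed
  show "0 < (\<tau> (k + j))\<^sup>2" if "j \<in> {1..d - k}" for j
    using face_index_pos[OF that] by simp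
qed

end

theorem theorem1p6:
  fixes d k :: nat and \<tau> :: "nat \<Rightarrow> real"
    and e :: "nat \<Rightarrow> 'a::euclidean_space" and S F :: "'a set"
  assumes "d \<ge> 2"
    and "\<And>i. i \<le> d \<Longrightarrow> \<tau> i > 0"
    and "bij_betw e {0..d} Basis"
    and "S = convex hull ((\<lambda>i. e i /\<^sub>R \<tau> i) ` {0..d})"
    and "k \<le> d"
    and "F = convex hull ((\<lambda>i. e i /\<^sub>R \<tau> i) ` {0..k})"
  shows "internal_angle F S =
           g_fun (d - k) (- (\<Sum>i=0..d. (\<tau> i)\<^sup>2)) (\<lambda>j. (\<tau> (k + j))\<^sup>2) (\<lambda>_. 1) \<and>
         external_angle F S =
           g_fun (d - k) (\<Sum>i=0..k. (\<tau> i)\<^sup>2) (\<lambda>j. (\<tau> (k + j))\<^sup>2) (\<lambda>_. 1) \<and>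
         (\<forall>(l::nat) (lam0::real) (lam::nat \<Rightarrow> real).
            (\<forall>j\<in>{1..l}. lam j > 0) \<longrightarrow> (lam0 > 0 \<or> lam0 < - (\<Sum>j=1..l. lam j)) \<longrightarrow>
            (let f = (\<lambda>x::real. (\<Prod>j=1..l. gauss_Phi (sqrt_ratio (lam j) lam0 * of_real x)) *
                        of_real (exp (- x\<^sup>2 / 2)))
             in integrable lborel f \<and>
                of_real (g_fun l lam0 lam (\<lambda>_. 1)) =
                  1 / of_real (sqrt (2 * pi)) * (LINT x|lborel. f x)))"
proof -
  interpret weighted_simplex d k \<tau> e S F
    using assms by unfold_locales auto
  show ?thesis
    using internal_angle_F_S external_angle_F_S g_fun_integral_positive g_fun_integral_negative
    by (auto simp only: Let_def)
qed

end
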